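(* Let $\mathbf{x}_1,\dots,\mathbf{x}_n\in\mathbb{R}^d$ be fixed and let $\mathbf{y}_1,\dots,\mathbf{y}_n$ be independent (not necessarily identically distributed) real random variables for which there is a constant $\sigma\ge0$ with $\mathbf{E}e^{t(\mathbf{y}_i-\mathbf{E}\mathbf{y}_i)}\le e^{\sigma^2t^2/2}$ for all $i$ and all $t\in\mathbb{R}$. Let $\hat A=\frac1n\sum_{i=1}^n\mathbf{x}_i\mathbf{x}_i^T$ and $a=(\sup_j\hat A_{j,j})^{1/2}$. Let $\bar\beta\in\mathbb{R}^d$ be the true target vector, i.e. $\mathbf{E}\mathbf{y}_i=\bar\beta^T\mathbf{x}_i$ for all $i$. Let $\lambda\ge0$ be the regularization parameter and let $\hat\beta$ be the solution of $$\hat\beta=\arg\min_{\beta\in\mathbb{R}^d}\Big[\frac1n\sum_{i=1}^n(\beta^T\mathbf{x}_i-\mathbf{y}_i)^2+\lambda\|\beta\|_1\Big].$$ Given $\delta\in(0,1)$, with probability larger than $1-\delta$ the following holds for all integers $k,\ell$ with $(d-k)/2\ge\ell\ge k$: if $t=1-\pi^{(2)}_{\hat A,k+\ell,\ell}k^{0.5}/\ell>0$ and $\lambda\ge4(2-t)t^{-1}\sigma a\sqrt{2\ln(2d/\delta)/n}$, then $$\|\hat\beta-\bar\beta\|_2\le\Big(\frac{32\rho^{(2)}_{\hat A,k+\ell}}{t\mu^{(2)}_{\hat A,k+\ell}}+4\Big)\frac{r_k^{(1)}(\bar\beta)}{\sqrt\ell}+\Big(\frac{8\rho^{(2)}_{\hat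 A,k+\ell}}{t\mu^{(2)}_{\hat A,k+\ell}}+4\Big)r_k^{(2)}(\bar\beta)+\frac{8}{t\mu^{(2)}_{\hat A,k+\ell}}\sqrt{k}\,\lambda.$$
   Context: For $\beta\in\mathbb{R}^d$ with $|\beta_{(1)}|\ge\cdots\ge|\beta_{(d)}|$ in descending order, $r_k^{(p)}(\beta)=\big(\sum_{j=k+1}^d|\beta_{(j)}|^p\big)^{1/p}$. For a positive semi-definite $A\in\mathbb{R}^{d\times d}$ and $k,\ell\ge1$ with $k+\ell\le d$, let $I,J$ range over disjoint subsets of $\{1,\dots,d\}$ with $k$ and $\ell$ elements, $A_{I,J}$ be the restriction of $A$ to row indices $I$ and column indices $J$, and $\mathbf{v}\in\mathbb{R}^k$, $\mathbf{u}\in\mathbb{R}^\ell$ range over (nonzero) vectors. Define $$\rho^{(2)}_{A,k}=\sup_{\mathbf{v},I}\frac{\|A_{I,I}\mathbf{v}\|_2}{\|\mathbf{v}\|_2},\quad\mu^{(2)}_{A,k}=\inf_{\mathbf{v},I}\frac{\|A_{I,I}\mathbf{v}\|_2}{\|\mathbf{v}\|_2},\quad\pi^{(2)}_{A,k,\ell}=\sup_{\mathbf{v},\mathbf{u},I,J}\frac{\mathbf{v}^TA_{I,J}\mathbf{u}\,\|\mathbf{v}\|_2}{\max(0,\mathbf{v}^TA_{I,I}\mathbf{v})\,\|\mathbf{u}\|_\infty}.$$ A ratio with zero denominator is read as $+\infty$. *)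

theory Defs
  imports "HOL-Probability.Probability"
begin

text \<open>The absolute values of the coordinates of a vector, in descending order.\<close>

definition abs_desc :: "real ^ 'd \<Rightarrow> real list" where
  "abs_desc b = rev (sorted_list_of_multiset (image_mset (\<lambda>j. \<bar>b $ j\<bar>) (mset_set UNIV)))"

definition r_tail :: "real \<Rightarrow> nat \<Rightarrow> real ^ 'd \<Rightarrow> real" where
  "r_tail p k b = (\<Sum>z\<leftarrow>drop k (abs_desc b). z powr p) powr (1 / p)"

text \<open>
  Vectors of \<open>\<real>\<^sup>k\<close> paired with an index set \<open>I\<close> of \<open>k\<close> elements are functions on the index
  type of which only the values on \<open>I\<close> are used; \<open>L2_set v I\<close> is then the Euclidean norm
  of \<open>v\<close>.
\<close>

definition sub_mult :: "real ^ 'd ^ 'd \<Rightarrow> 'd set \<Rightarrow> 'd set \<Rightarrow> ('d \<Rightarrow> real) \<Rightarrow> 'd \<Rightarrow> real" where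
  "sub_mult A I J u i = (\<Sum>j\<in>J. A $ i $ j * u j)"

definition sub_form ::
  "real ^ 'd ^ 'd \<Rightarrow> 'd set \<Rightarrow> 'd set \<Rightarrow> ('d \<Rightarrow> real) \<Rightarrow> ('d \<Rightarrow> real) \<Rightarrow> real" where
  "sub_form A I J v u = (\<Sum>i\<in>I. v i * sub_mult A I J u i)"

definition linf_on :: "('d \<Rightarrow> real) \<Rightarrow> 'd set \<Rightarrow> real" where
  "linf_on u J = Max ((\<lambda>j. \<bar>u j\<bar>) ` J)"

definition nonzero_on :: "('d \<Rightarrow> real) \<Rightarrow> 'd set \<Rightarrow> bool" where
  "nonzero_on v I \<longleftrightarrow> (\<exists>i\<in>I. v i \<noteq> 0)"

text \<open>
  The ratios in the next two definitions have nonzero denominators and form a bounded set,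
  nonempty for \<open>1 \<le> k \<le> CARD('d)\<close>, so the supremum and infimum can be taken in the reals.
\<close>

definition rho2 :: "real ^ 'd ^ 'd \<Rightarrow> nat \<Rightarrow> real" where
  "rho2 A k = (SUP (v, I) \<in> {(v, I). card I = k \<and> nonzero_on v I}.
     L2_set (sub_mult A I I v) I / L2_set v I)"

definition mu2 :: "real ^ 'd ^ 'd \<Rightarrow> nat \<Rightarrow> real" where
  "mu2 A k = (INF (v, I) \<in> {(v, I). card I = k \<and> nonzero_on v I}.
     L2_set (sub_mult A I I v) I / L2_set v I)"

definition ext_ratio :: "real \<Rightarrow> real \<Rightarrow> ereal" where
  "ext_ratio a b = (if b = 0 then \<infinity> else ereal (a / b))"

definition pi2 :: "real ^ 'd ^ 'd \<Rightarrow> nat \<Rightarrow> nat \<Rightarrow> ereal" where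
  "pi2 A k l =
     (SUP (v, u, I, J) \<in> {(v, u, I, J). card I = k \<and> card J = l \<and> I \<inter> J = {} \<and>
                                        nonzero_on v I \<and> nonzero_on u J}.
        ext_ratio (sub_form A I J v u * L2_set v I)
                  (max 0 (sub_form A I I v v) * linf_on u J))"

definition emp_gram :: "nat \<Rightarrow> (nat \<Rightarrow> real ^ 'd) \<Rightarrow> real ^ 'd ^ 'd" where
  "emp_gram n x = (1 / real n) *\<^sub>R (\<Sum>i\<in>{1..n}. (columnvector (x i) :: real ^ 1 ^ 'd) ** rowvector (x i))"

text \<open>
  For \<open>lam = 0\<close> the minimisers can form an unbounded affine space, even when all the
  restricted quantities above are well behaved, and no estimate can then hold for an arbitrary
  one. A statement about \<open>the\<close> minimiser needs its uniqueness in that case.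
\<close>

definition lasso_objective ::
  "nat \<Rightarrow> (nat \<Rightarrow> real ^ 'd) \<Rightarrow> (nat \<Rightarrow> real) \<Rightarrow> real \<Rightarrow> real ^ 'd \<Rightarrow> real" where
  "lasso_objective n x y lam b =
     (1 / real n) * (\<Sum>i\<in>{1..n}. (b \<bullet> x i - y i)\<^sup>2) + lam * (\<Sum>j\<in>UNIV. \<bar>b $ j\<bar>)"

end

theory Submission imports Defs begin

text \<open>
  The argument has a deterministic and a probabilistic half, which meet in one inequality: every
  coordinate of the noise vector \<open>z = (1/n) \<Sum>\<^sub>i (y\<^sub>i - E y\<^sub>i) x\<^sub>i\<close> is at most
  \<open>\<tau> = \<sigma> a \<surd>(2 ln (2d/\<delta>) / n)\<close> in absolute value. The noise is centred and its \<open>j\<close>-th coordinate is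
  sub-Gaussian with variance proxy \<open>\<sigma>\<^sup>2 A\<^sub>j\<^sub>j / n \<le> \<sigma>\<^sup>2 a\<^sup>2 / n\<close>, so Chernoff's inequality and a union bound
  over the \<open>2d\<close> signed coordinates give this event a probability larger than \<open>1 - \<delta>\<close>
  (\<open>score_sup_bound\<close>). The event does not depend on \<open>k\<close>, \<open>l\<close> or \<open>t\<close>; everything else holds pointwise
  on it.

  Let \<open>F\<close> be the set of the \<open>k\<close> largest coordinates of \<open>\<beta>bar\<close>, and compare \<open>\<beta>hat\<close> with the truncation
  of \<open>\<beta>bar\<close> to \<open>F\<close> instead of \<open>\<beta>bar\<close> itself: put \<open>D = \<beta>hat - \<beta>bar\<^sub>F\<close>. Let \<open>G\<close> be the \<open>l\<close> largest
  coordinates of \<open>D\<close> outside \<open>F\<close>, \<open>I = F \<union> G\<close> and \<open>N = \<parallel>D\<^sub>I\<parallel>\<^sub>2\<close>. Convexity gives a variational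
  inequality at the minimiser (\<open>lasso_variational_inequality\<close>), which is tested against two points.

  Testing against \<open>\<beta>bar\<close> yields the cone condition \<open>lasso_cone\<close>: the l1 norm of \<open>D\<close> off \<open>F\<close> is bounded by
  a multiple of its l1 norm on \<open>F\<close> plus the tail \<open>r\<^sub>1\<close> of \<open>\<beta>bar\<close>. Testing against \<open>\<beta>hat - D\<^sub>I\<close> yields an
  upper bound for \<open>D\<^sub>I\<^sup>T A D\<close> (\<open>lasso_local_upper\<close>). Here the truncation pays off: \<open>\<beta>hat - D\<^sub>I\<close> vanishes
  on \<open>G\<close>, so the penalty contributes no term \<open>\<lambda> r\<^sub>1\<close>. The price is the product \<open>D\<^sub>I\<^sup>T A \<beta>bar\<close> over
  the complement of \<open>F\<close>, which is at most \<open>\<rho> N (r\<^sub>2 + r\<^sub>1 / \<surd>l)\<close> (\<open>form_tail_le_rho2\<close>).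

  In the other direction, \<open>D\<^sub>I\<^sup>T A D\<close> differs from \<open>Q = D\<^sub>I\<^sup>T A D\<^sub>I\<close> by a product of \<open>A D\<^sub>I\<close> and \<open>D\<close> outside
  \<open>I\<close>. There \<open>D\<close> is spread out, because the largest entries were moved into \<open>G\<close>, and a spread-out vector
  pairs with \<open>A D\<^sub>I\<close> no better than \<open>l\<close> equal entries would (\<open>sum_mult_le_top_sum\<close>). Sums of \<open>l\<close> entries
  of \<open>A D\<^sub>I\<close> are what \<open>\<pi>\<close> controls; by the cone condition they absorb at most the fraction \<open>1 - t/2\<close> of
  \<open>Q\<close>, which leaves \<open>Q t / 2\<close>, up to a term \<open>3 \<rho> N r\<^sub>1 / \<surd>l\<close> (\<open>form_local_lower\<close>). Finally \<open>Q \<ge> \<mu> N\<^sup>2\<close>, because \<open>\<mu>\<close> is the smallest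
  eigenvalue of all principal blocks of the given size (\<open>mu2_is_min_eigenvalue\<close>). This bounds \<open>N\<close>;
  the part of \<open>D\<close> outside \<open>I\<close> is again bounded by the cone condition, and \<open>\<parallel>\<beta>hat - \<beta>bar\<parallel> \<le> \<parallel>D\<parallel> + r\<^sub>2\<close>.
\<close>

section \<open>Vectors restricted to an index set\<close>

text \<open>
  Restricted vectors stay in the ambient space, padded with zeros. In this way blocks of different
  sizes and positions live in one type, and every block quantity of \<open>A\<close> becomes a norm or an inner
  product involving \<open>A *v restr I v\<close>.
\<close>

definition restr :: "'d set \<Rightarrow> real ^ 'd \<Rightarrow> real ^ 'd" where
  "restr I v = (\<chi> i. if i \<in> I then v $ i else 0)"

lemma restr_nth [simp]: "restr I v $ i = (if i \<in> I then v $ i else 0)"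
  by (simp add: restr_def)

lemma restr_add: "restr I (u + v) = restr I u + restr I v"
  and restr_scaleR: "restr I (c *\<^sub>R v) = c *\<^sub>R restr I v"
  and restr_diff: "restr I (u - v) = restr I u - restr I v"
  and restr_restr: "restr I (restr J v) = restr (I \<inter> J) v"
  by (simp_all add: vec_eq_iff)

lemma restr_0 [simp]: "restr I 0 = 0"
  by (simp add: vec_eq_iff)

lemma inner_restr: "restr I v \<bullet> w = (\<Sum>i\<in>I. v $ i * w $ i)"
proof -
  have "restr I v \<bullet> w = (\<Sum>i\<in>UNIV. if i \<in> I then v $ i * w $ i else 0)"
    unfolding inner_vec_def by (intro sum.cong) auto
  also have "\<dots> = (\<Sum>i\<in>I. v $ i * w $ i)"
    by (simp add: sum.If_cases)
  finally show ?thesis .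
qed

lemma inner_restr_both: "restr I v \<bullet> restr I w = restr I v \<bullet> w"
  unfolding inner_restr by simp

lemma norm_restr_sq: "(norm (restr I v))\<^sup>2 = (\<Sum>i\<in>I. (v $ i)\<^sup>2)"
  by (simp only: power2_norm_eq_inner inner_restr_both) (simp add: inner_restr power2_eq_square)

lemma norm_restr: "norm (restr I v) = L2_set (($) v) I"
  by (metis L2_set_def norm_ge_zero norm_restr_sq real_sqrt_unique)

lemma norm_restr_le: "norm (restr I v) \<le> norm v"
  by (rule norm_le_componentwise_cart) simp

lemma norm_restr_mono: "I \<subseteq> J \<Longrightarrow> norm (restr I v) \<le> norm (restr J v)"
  by (rule norm_le_componentwise_cart) auto

lemma restr_split: "v = restr I v + restr (- I) v"
  by (simp add: vec_eq_iff)

lemma sum_abs_le_norm_restr: "(\<Sum>i\<in>I. \<bar>v $ i\<bar>) \<le> sqrt (real (card I)) * norm (restr I v)"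
  using L2_set_mult_ineq[of "\<lambda>_. 1" "\<lambda>i. v $ i" I]
  by (simp add: norm_restr L2_set_def)

lemma restr_inner_le: "restr I v \<bullet> w \<le> norm (restr I v) * norm (restr I w)"
  by (metis inner_restr_both norm_cauchy_schwarz)

lemma sub_mult_eq: "sub_mult A I J u i = (A *v restr J (\<chi> j. u j)) $ i"
proof -
  have "(A *v restr J (\<chi> j. u j)) $ i = (\<Sum>j\<in>UNIV. if j \<in> J then A $ i $ j * u j else 0)"
    unfolding matrix_vector_mult_def by (simp, intro sum.cong) auto
  then show ?thesis by (simp add: sub_mult_def sum.If_cases)
qed

lemma sub_form_eq:
  "sub_form A I J v u = restr I (\<chi> j. v j) \<bullet> (A *v restr J (\<chi> j. u j))"
  by (simp add: sub_form_def sub_mult_eq inner_restr)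

lemma ratio_eq:
  "L2_set (sub_mult A I I v) I / L2_set v I =
     norm (restr I (A *v restr I (\<chi> j. v j))) / norm (restr I (\<chi> j. v j))"
  by (simp add: norm_restr sub_mult_eq L2_set_def)

lemma nonzero_on_iff: "nonzero_on v I \<longleftrightarrow> restr I (\<chi> j. v j) \<noteq> 0"
  by (auto simp: nonzero_on_def vec_eq_iff)

section \<open>Positive semidefinite forms and restricted eigenvalues\<close>

definition psd :: "real ^ 'd ^ 'd \<Rightarrow> bool" where
  "psd A \<longleftrightarrow> (\<forall>u v. u \<bullet> (A *v v) = v \<bullet> (A *v u)) \<and> (\<forall>v. 0 \<le> v \<bullet> (A *v v))"

lemma rho2_ratio_le:
  fixes A :: "real ^ 'd ^ 'd"
  assumes "card I = m" "nonzero_on v I"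
  shows "L2_set (sub_mult A I I v) I / L2_set v I \<le> rho2 A m"
proof -
  have "bdd_above ((\<lambda>(v, I). L2_set (sub_mult A I I v) I / L2_set v I) `
           {(v, I). card I = m \<and> nonzero_on v I})"
  proof (rule bdd_aboveI2, clarify)
    fix v :: "'d \<Rightarrow> real" and I :: "'d set" assume nz: "nonzero_on v I"
    let ?u = "restr I (\<chi> j. v j)"
    have "norm (restr I (A *v ?u)) \<le> norm (A *v ?u)" by (rule norm_restr_le)
    also have "\<dots> \<le> onorm ((*v) A) * norm ?u"
      by (intro onorm matrix_vector_mul_bounded_linear)
    finally show "L2_set (sub_mult A I I v) I / L2_set v I \<le> onorm ((*v) A)"
      using nz by (simp add: ratio_eq nonzero_on_iff field_simps)
  qed
  then show ?thesis unfolding rho2_def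
    using cSUP_upper[of "(v, I)" "{(v, I). card I = m \<and> nonzero_on v I}"
        "\<lambda>(v, I). L2_set (sub_mult A I I v) I / L2_set v I"] assms by auto
qed

lemma norm_restr_mult_le_rho2:
  assumes "card I = m"
  shows "norm (restr I (A *v restr I v)) \<le> rho2 A m * norm (restr I v)"
proof (cases "restr I v = 0")
  case False
  then show ?thesis
    using rho2_ratio_le[of I m "\<lambda>j. v $ j" A] assms
    by (simp add: ratio_eq nonzero_on_iff field_simps)
qed simp

lemma form_le_rho2:
  assumes "card I = m"
  shows "restr I v \<bullet> (A *v restr I v) \<le> rho2 A m * (norm (restr I v))\<^sup>2"
proof -
  have "restr I v \<bullet> (A *v restr I v) \<le> norm (restr I v) * norm (restr I (A *v restr I v))"
    by (rule restr_inner_le)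
  also have "\<dots> \<le> norm (restr I v) * (rho2 A m * norm (restr I v))"
    by (intro mult_left_mono norm_restr_mult_le_rho2 assms) auto
  finally show ?thesis by (simp add: power2_eq_square algebra_simps)
qed

lemma rho2_nonneg:
  fixes A :: "real ^ 'd ^ 'd"
  assumes "1 \<le> m" "m \<le> CARD('d)"
  shows "0 \<le> rho2 A m"
proof -
  obtain I :: "'d set" where I: "card I = m" using assms(2) by (metis obtain_subset_with_card_n)
  then have "I \<noteq> {}" using assms(1) by auto
  then have "nonzero_on (\<lambda>_. 1) I" by (auto simp: nonzero_on_def)
  then have "L2_set (sub_mult A I I (\<lambda>_. 1)) I / L2_set (\<lambda>_. 1) I \<le> rho2 A m"
    using I rho2_ratio_le by blast
  then show ?thesis by (smt (verit) L2_set_nonneg divide_nonneg_nonneg)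
qed

text \<open>
  Nonnegativity of the form on the plane spanned by \<open>u\<close> and \<open>v\<close>, evaluated where the quadratic polynomial
  is smallest. When the form vanishes at \<open>v\<close> that polynomial is affine, hence constant.
\<close>

lemma psd_cauchy_schwarz:
  assumes "psd A"
  shows "(u \<bullet> (A *v v))\<^sup>2 \<le> (u \<bullet> (A *v u)) * (v \<bullet> (A *v v))"
proof -
  let ?a = "u \<bullet> (A *v u)" and ?b = "u \<bullet> (A *v v)" and ?c = "v \<bullet> (A *v v)"
  have q: "0 \<le> x\<^sup>2 * ?a + 2 * (x * y) * ?b + y\<^sup>2 * ?c" for x y
  proof -
    have "0 \<le> (x *\<^sub>R u + y *\<^sub>R v) \<bullet> (A *v (x *\<^sub>R u + y *\<^sub>R v))"
      using assms by (simp add: psd_def)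
    also have "\<dots> = x\<^sup>2 * ?a + (x * y) * ?b + (x * y) * (v \<bullet> (A *v u)) + y\<^sup>2 * ?c"
      by (simp add: matrix_vector_right_distrib matrix_vector_mult_scaleR
          inner_add_left inner_add_right power2_eq_square algebra_simps)
    also have "v \<bullet> (A *v u) = ?b" using assms psd_def by metis
    finally show ?thesis by (simp add: algebra_simps)
  qed
  show ?thesis
  proof (cases "?c = 0")
    case True
    have "?b = 0"
    proof (rule ccontr)
      assume b: "?b \<noteq> 0"
      have "0 \<le> ?a + 2 * (- (?a + 1) / (2 * ?b)) * ?b"
        using q[of 1 "- (?a + 1) / (2 * ?b)"] True by simp
      then show False using b by (simp add: field_simps)
    qed
    then show ?thesis using True by simp
  next
    case False
    then have c: "?c > 0" using assms by (metis psd_def less_eq_real_def)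
    have "0 \<le> ?c * (?c * ?a - ?b\<^sup>2)"
      using q[of ?c "- ?b"] by (simp add: algebra_simps power2_eq_square)
    then show ?thesis using c by (simp add: zero_le_mult_iff algebra_simps)
  qed
qed

text \<open>
  The supremum \<open>rho2\<close> is over principal blocks, but semidefiniteness extends the bound to all blocks
  with rows \<open>J\<close> and columns \<open>I\<close>: for \<open>z\<close> the restriction of \<open>A v\<^sub>I\<close> to \<open>J\<close>, Cauchy-Schwarz splits
  \<open>\<parallel>z\<parallel>\<^sup>2 = z\<^sup>T A v\<^sub>I\<close> into two principal forms. The sets may overlap.
\<close>

lemma norm_restr_mult_le_rho2_cross:
  fixes A :: "real ^ 'd ^ 'd"
  assumes "psd A" "card I = m" "card J \<le> m"
  shows "norm (restr J (A *v restr I v)) \<le> rho2 A m * norm (restr I v)"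
proof (cases "restr J (A *v restr I v) = 0 \<or> restr I v = 0")
  case True
  show ?thesis
  proof (cases "restr I v = 0")
    case False
    have "0 \<le> norm (restr I (A *v restr I v))" by simp
    also have "\<dots> \<le> rho2 A m * norm (restr I v)" using assms norm_restr_mult_le_rho2 by blast
    finally show ?thesis using True False by simp
  qed simp
next
  case False
  have "m \<le> CARD('d)" using assms(2) by (metis card_mono finite top_greatest)
  \<comment> \<open>A principal block of exactly \<open>m\<close> rows is needed, so \<open>J\<close> is padded.\<close>
  then obtain K where K: "J \<subseteq> K" "card K = m"
    using assms(3) by (metis exists_subset_between finite subset_UNIV)
  let ?z = "restr J (A *v restr I v)"
  have zK: "restr K ?z = ?z" using K(1) by (auto simp: vec_eq_iff)
  have "(norm ?z)\<^sup>2 = ?z \<bullet> (A *v restr I v)"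
    by (simp add: power2_norm_eq_inner inner_restr_both)
  then have "((norm ?z)\<^sup>2)\<^sup>2 \<le> (?z \<bullet> (A *v ?z)) * (restr I v \<bullet> (A *v restr I v))"
    using psd_cauchy_schwarz[OF assms(1)] by metis
  also have "\<dots> \<le> (rho2 A m * (norm ?z)\<^sup>2) * (rho2 A m * (norm (restr I v))\<^sup>2)"
  proof (rule mult_mono)
    show "?z \<bullet> (A *v ?z) \<le> rho2 A m * (norm ?z)\<^sup>2"
      using form_le_rho2[OF K(2), of ?z A] zK by simp
    show "restr I v \<bullet> (A *v restr I v) \<le> rho2 A m * (norm (restr I v))\<^sup>2"
      by (rule form_le_rho2[OF assms(2)])
    show "0 \<le> restr I v \<bullet> (A *v restr I v)" using assms(1) by (simp add: psd_def)
    show "0 \<le> rho2 A m * (norm ?z)\<^sup>2"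
      using form_le_rho2[OF K(2), of ?z A] zK assms(1) by (metis psd_def order_trans)
  qed
  also have "\<dots> = (norm ?z)\<^sup>2 * (rho2 A m * norm (restr I v))\<^sup>2"
    by (simp add: power2_eq_square)
  finally have "(norm ?z)\<^sup>2 \<le> (rho2 A m * norm (restr I v))\<^sup>2"
    using False by (simp add: power2_eq_square)
  moreover have "0 \<le> rho2 A m * norm (restr I v)"
    using norm_restr_mult_le_rho2[OF assms(2), of A v] norm_ge_zero order_trans by blast
  ultimately show ?thesis by (rule power2_le_imp_le)
qed

lemma mu2_ratio_ge:
  assumes "card I = m" "nonzero_on v I"
  shows "mu2 A m \<le> L2_set (sub_mult A I I v) I / L2_set v I"
proof -
  have "bdd_below ((\<lambda>(v, I). L2_set (sub_mult A I I v) I / L2_set v I) `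
           {(v, I). card I = m \<and> nonzero_on v I})"
    by (rule bdd_belowI2[of _ 0]) (auto simp: L2_set_nonneg)
  then show ?thesis unfolding mu2_def
    using cINF_lower[of "\<lambda>(v, I). L2_set (sub_mult A I I v) I / L2_set v I" "{(v, I). card I = m \<and> nonzero_on v I}"
        "(v, I)"] assms by auto
qed

lemma mu2_greatest:
  fixes A :: "real ^ 'd ^ 'd"
  assumes "1 \<le> m" "m \<le> CARD('d)"
    and "\<And>v I. card I = m \<Longrightarrow> nonzero_on v I \<Longrightarrow> c \<le> L2_set (sub_mult A I I v) I / L2_set v I"
  shows "c \<le> mu2 A m"
proof -
  obtain I :: "'d set" where I: "card I = m" using assms(2) by (metis obtain_subset_with_card_n)
  then have "I \<noteq> {}" using assms(1) by auto
  then have "nonzero_on (\<lambda>_. 1) I" by (auto simp: nonzero_on_def)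
  then show ?thesis unfolding mu2_def using I assms(3)
    by (intro cINF_greatest) auto
qed

lemma linear_term_zero:
  fixes b c :: real
  assumes "\<And>h. 0 \<le> h * b + h\<^sup>2 * c" "c \<ge> 0"
  shows "b = 0"
proof (rule ccontr)
  assume b: "b \<noteq> 0"
  have "0 \<le> (c + 1)\<^sup>2 * ((- b / (c + 1)) * b + (- b / (c + 1))\<^sup>2 * c)"
    by (intro mult_nonneg_nonneg assms) auto
  also have "\<dots> = - (b\<^sup>2)"
    using assms(2) by (simp add: divide_simps power2_eq_square) algebra
  finally show False using b by simp
qed

text \<open>
  The form attains its minimum \<open>c\<close> over the compact set of unit vectors supported on some \<open>m\<close> indices.
  First-order optimality within the support \<open>I\<close> of a minimiser \<open>v\<close> says \<open>A\<^sub>I\<^sub>I v = c v\<close>, so the ratio that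
  defines \<open>mu2\<close> takes the value \<open>c\<close> at \<open>v\<close>. It is never smaller than \<open>c\<close>, by Cauchy-Schwarz. So the
  infimum of \<open>\<parallel>A\<^sub>I\<^sub>I v\<parallel>\<close> over unit vectors is also a lower bound for the quadratic form, which is the way it is used below.
\<close>

lemma mu2_is_min_eigenvalue:
  fixes A :: "real ^ 'd ^ 'd"
  assumes "psd A" "1 \<le> m" "m \<le> CARD('d)"
  shows "\<exists>I v. card I = m \<and> restr I v = v \<and> norm v = 1 \<and> mu2 A m = v \<bullet> (A *v v) \<and>
    (\<forall>J u. card J = m \<longrightarrow> mu2 A m * (norm (restr J u))\<^sup>2 \<le> restr J u \<bullet> (A *v restr J u))"
proof -
  define S where "S = (\<Union>I\<in>{I::'d set. card I = m}. sphere 0 1 \<inter> {v :: real ^ 'd. \<forall>i. i \<notin> I \<longrightarrow> v $ i = 0})"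
  have clos: "closed {v :: real ^ 'd. \<forall>i. i \<notin> I \<longrightarrow> v $ i = 0}" for I
  proof -
    have "{v :: real ^ 'd. \<forall>i. i \<notin> I \<longrightarrow> v $ i = 0} = (\<Inter>i\<in>-I. {v. v $ i = 0})" by auto
    also have "closed \<dots>" by (intro closed_INT ballI closed_Collect_eq continuous_intros)
    finally show ?thesis .
  qed
  have "compact S" unfolding S_def
    by (intro compact_UN compact_Int_closed clos) auto
  moreover have "S \<noteq> {}"
  proof -
    obtain I :: "'d set" where I: "card I = m" using assms(3) by (metis obtain_subset_with_card_n)
    then obtain i where "i \<in> I" using assms(2) by fastforce
    then have "axis i 1 \<in> S" unfolding S_def using I by (auto simp: norm_axis_1) (auto simp: axis_def)
    then show ?thesis by auto
  qed
  moreover have "continuous_on S (\<lambda>v. v \<bullet> (A *v v))"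
    by (intro continuous_intros linear_continuous_on matrix_vector_mul_bounded_linear)
  ultimately obtain v where v: "v \<in> S" and min: "\<And>u. u \<in> S \<Longrightarrow> v \<bullet> (A *v v) \<le> u \<bullet> (A *v u)"
    using continuous_attains_inf by metis
  then obtain I where I: "card I = m" "norm v = 1" "\<And>i. i \<notin> I \<Longrightarrow> v $ i = 0"
    by (auto simp: S_def)
  define c where "c = v \<bullet> (A *v v)"
  have lower: "c * (norm (restr J u))\<^sup>2 \<le> restr J u \<bullet> (A *v restr J u)" if J: "card J = m" for J u
  proof (cases "restr J u = 0")
    case False
    let ?w = "(1 / norm (restr J u)) *\<^sub>R restr J u"
    have "?w \<in> S" unfolding S_def using J False by (intro UN_I[of J]) auto
    then have "c \<le> ?w \<bullet> (A *v ?w)" unfolding c_def by (rule min)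
    also have "\<dots> = restr J u \<bullet> (A *v restr J u) / (norm (restr J u))\<^sup>2"
      by (simp add: matrix_vector_mult_scaleR power2_eq_square)
    finally show ?thesis using False by (simp add: field_simps)
  qed simp
  have rv: "restr I v = v" using I(3) by (auto simp: vec_eq_iff)
  have c0: "c \<ge> 0" using assms(1) by (simp add: c_def psd_def)
  have sphere: "v \<bullet> v = 1" using I(2) by (metis norm_eq_1)
  have "restr I (A *v v) = c *\<^sub>R v"
  proof -
    define u where "u = restr I (A *v v) - c *\<^sub>R v"
    have ru: "restr I u = u" using rv by (simp add: u_def restr_diff restr_restr restr_scaleR)
    \<comment> \<open>The form minus \<open>c\<close> times the squared norm is nonnegative along \<open>v + h u\<close> and zero at \<open>h = 0\<close>.\<close>
    have "2 * (u \<bullet> (A *v v) - c * (u \<bullet> v)) = 0"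
    proof (rule linear_term_zero)
      show "0 \<le> u \<bullet> (A *v u) - c * (u \<bullet> u)"
        using lower[OF I(1), of u] ru by (simp add: power2_norm_eq_inner)
      fix h
      have "c * (norm (v + h *\<^sub>R u))\<^sup>2 \<le> (v + h *\<^sub>R u) \<bullet> (A *v (v + h *\<^sub>R u))"
        using lower[OF I(1), of "v + h *\<^sub>R u"] ru rv by (simp add: restr_add restr_scaleR)
      moreover have "(norm (v + h *\<^sub>R u))\<^sup>2 = 1 + 2 * h * (u \<bullet> v) + h\<^sup>2 * (u \<bullet> u)"
        unfolding power2_norm_eq_inner using sphere
        by (simp add: inner_add_left inner_add_right inner_commute power2_eq_square)
      moreover have "v \<bullet> (A *v u) = u \<bullet> (A *v v)" using assms(1) by (simp add: psd_def)
      ultimately show "0 \<le> h * (2 * (u \<bullet> (A *v v) - c * (u \<bullet> v))) + h\<^sup>2 * (u \<bullet> (A *v u) - c * (u \<bullet> u))"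
        using c_def
        by (simp add: matrix_vector_right_distrib matrix_vector_mult_scaleR
            inner_add_left inner_add_right inner_commute power2_eq_square algebra_simps)
    qed
    then have "u \<bullet> (restr I (A *v v) - c *\<^sub>R v) = 0"
      using inner_restr_both[of I u "A *v v"] ru by (simp add: inner_diff_right)
    then have "u = 0" by (simp add: u_def)
    then show ?thesis by (simp add: u_def)
  qed
  moreover have "mu2 A m \<le> L2_set (sub_mult A I I (($) v)) I / L2_set (($) v) I"
    using I(2) rv by (intro mu2_ratio_ge I(1)) (auto simp: nonzero_on_iff)
  ultimately have "mu2 A m \<le> c"
    using rv I(2) c0 by (simp add: ratio_eq)
  moreover have "c \<le> mu2 A m"
  proof (rule mu2_greatest[OF assms(2,3)])
    fix u :: "'d \<Rightarrow> real" and J :: "'d set" assume J: "card J = m" "nonzero_on u J"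
    let ?u = "restr J (\<chi> j. u j)"
    have "c * (norm ?u)\<^sup>2 \<le> norm ?u * norm (restr J (A *v ?u))"
      using lower[OF J(1)] restr_inner_le order_trans by blast
    then show "c \<le> L2_set (sub_mult A J J u) J / L2_set u J"
      using J(2) by (simp add: ratio_eq nonzero_on_iff field_simps power2_eq_square)
  qed
  ultimately have "mu2 A m = c" by simp
  then show ?thesis using I(1,2) rv lower c_def by (intro exI[of _ I] exI[of _ v]) simp
qed

lemma mu2_le_form:
  fixes A :: "real ^ 'd ^ 'd"
  assumes "psd A" "1 \<le> m" "card J = m"
  shows "mu2 A m * (norm (restr J u))\<^sup>2 \<le> restr J u \<bullet> (A *v restr J u)"
proof -
  have "m \<le> CARD('d)" using assms(3) by (metis card_mono finite top_greatest)
  then show ?thesis using mu2_is_min_eigenvalue[OF assms(1,2)] assms(3) by blast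
qed

section \<open>The cross-correlation ratio\<close>

lemma pi2_finite:
  assumes "ereal t = 1 - pi2 A m l * ereal (sqrt (real k)) / ereal (real l)" "1 \<le> k" "1 \<le> l"
  obtains r where "pi2 A m l = ereal r" "t = 1 - r * sqrt (real k) / real l"
proof (cases "pi2 A m l")
  case (real r)
  then show ?thesis using assms by (intro that[of r]) (auto simp: one_ereal_def)
next
  case PInf
  then show ?thesis using assms by (simp add: one_ereal_def)
next
  case MInf
  then show ?thesis using assms by (simp add: one_ereal_def)
qed

text \<open>
  The defining ratio is applied to the sign vector of \<open>A v\<^sub>I\<close> on \<open>J\<close>, whose supremum norm is one; the product
  then sums absolute values. A zero denominator would have made the supremum infinite, so finiteness
  also forces the form to be positive.
\<close>

lemma sum_abs_le_pi2:
  fixes A :: "real ^ 'd ^ 'd"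
  assumes "psd A" "pi2 A m l = ereal r"
    and "card I = m" "card J = l" "I \<inter> J = {}" "1 \<le> l" "restr I v \<noteq> 0"
  shows "0 < restr I v \<bullet> (A *v restr I v)"
    and "(\<Sum>j\<in>J. \<bar>(A *v restr I v) $ j\<bar>) * norm (restr I v) \<le> r * (restr I v \<bullet> (A *v restr I v))"
    and "0 \<le> r"
proof -
  let ?w = "A *v restr I v" and ?Q = "restr I v \<bullet> (A *v restr I v)"
  \<comment> \<open>Zero entries get the sign \<open>1\<close>, so that the vector is never zero.\<close>
  define s where "s = (\<lambda>j. if 0 \<le> ?w $ j then 1 else - 1 :: real)"
  have J: "J \<noteq> {}" using assms(4,6) by auto
  have lin: "linf_on u J = 1" if "\<And>j. \<bar>u j\<bar> = 1" for u :: "'d \<Rightarrow> real"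
    using J by (simp add: linf_on_def that image_constant_conv)
  have ratio: "ext_ratio (restr I v \<bullet> (A *v restr J (\<chi> j. u j)) * norm (restr I v)) (max 0 ?Q) \<le> ereal r"
    if u: "\<And>j. \<bar>u j\<bar> = 1" for u :: "'d \<Rightarrow> real"
  proof -
    have "nonzero_on (($) v) I" using assms(7) by (simp add: nonzero_on_iff)
    moreover have "nonzero_on u J" using J u unfolding nonzero_on_def by (metis abs_zero all_not_in_conv zero_neq_one)
    ultimately have "ext_ratio (sub_form A I J (($) v) u * L2_set (($) v) I)
         (max 0 (sub_form A I I (($) v) (($) v)) * linf_on u J) \<le> pi2 A m l"
      unfolding pi2_def using assms(3-5)
      by (intro SUP_upper2[of "(($) v, u, I, J)"]) auto
    then show ?thesis using lin[OF u] assms(2) by (simp add: sub_form_eq norm_restr)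
  qed
  have form: "restr I v \<bullet> (A *v restr J (\<chi> j. u j)) = (\<Sum>j\<in>J. u j * ?w $ j)" for u
  proof -
    have "restr I v \<bullet> (A *v restr J (\<chi> j. u j)) = restr J (\<chi> j. u j) \<bullet> ?w"
      using assms(1) psd_def by metis
    then show ?thesis by (simp add: inner_restr)
  qed
  have s1: "\<bar>s j\<bar> = 1" for j by (simp add: s_def)
  have "max 0 ?Q \<noteq> 0" using ratio[of s, OF s1] by (auto simp: ext_ratio_def)
  then show Q: "0 < ?Q" by (simp add: max_def split: if_splits)
  have le: "(\<Sum>j\<in>J. u j * ?w $ j) * norm (restr I v) \<le> r * ?Q" if "\<And>j. \<bar>u j\<bar> = 1" for u
    using ratio[of u] that Q form[of u] by (simp add: ext_ratio_def max_def pos_divide_le_eq)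
  have "(\<Sum>j\<in>J. s j * ?w $ j) = (\<Sum>j\<in>J. \<bar>?w $ j\<bar>)" by (intro sum.cong) (auto simp: s_def)
  then show main: "(\<Sum>j\<in>J. \<bar>?w $ j\<bar>) * norm (restr I v) \<le> r * ?Q" using le[of s, OF s1] by simp
  have "0 \<le> (\<Sum>j\<in>J. \<bar>?w $ j\<bar>) * norm (restr I v)" by (simp add: sum_nonneg)
  then show "0 \<le> r" using main Q by (smt (verit) zero_le_mult_iff)
qed

text \<open>
  In the main bound \<open>mu2\<close> occurs as a divisor; its positivity is a consequence of the finiteness of
  \<open>pi2\<close>. The condition \<open>m + l \<le> d\<close> provides disjoint index sets, without which the supremum
  would be over the empty set. The sign of \<open>r\<close> gives \<open>t \<le> 1\<close>.
\<close>

lemma pi2_finite_imp: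
  fixes A :: "real ^ 'd ^ 'd"
  assumes "psd A" "pi2 A m l = ereal r" "1 \<le> m" "1 \<le> l" "m + l \<le> CARD('d)"
  shows "0 < mu2 A m" and "0 \<le> r"
proof -
  have "m \<le> CARD('d)" using assms(5) by simp
  then obtain I v where v: "card I = m" "restr I v = v" "norm v = 1" "mu2 A m = v \<bullet> (A *v v)"
    using mu2_is_min_eigenvalue[OF assms(1,3)] by blast
  have "card (- I) = CARD('d) - m" using v(1) by (simp add: Compl_eq_Diff_UNIV card_Diff_subset)
  then have "l \<le> card (- I)" using assms(5) by simp
  then obtain J where J: "J \<subseteq> - I" "card J = l" by (metis obtain_subset_with_card_n)
  have disj: "I \<inter> J = {}" using J(1) by auto
  have nz: "restr I v \<noteq> 0" using v(2,3) by auto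
  show "0 < mu2 A m"
    using sum_abs_le_pi2(1)[OF assms(1,2) v(1) J(2) disj assms(4) nz] v(2,4) by simp
  show "0 \<le> r" by (rule sum_abs_le_pi2(3)[OF assms(1,2) v(1) J(2) disj assms(4) nz])
qed

section \<open>Largest entries and spread-out vectors\<close>

lemma obtain_top_subset:
  fixes f :: "'a \<Rightarrow> real"
  assumes "finite S" "l \<le> card S"
  obtains T where "T \<subseteq> S" "card T = l" "\<And>i j. i \<in> T \<Longrightarrow> j \<in> S - T \<Longrightarrow> f j \<le> f i"
proof -
  have "\<exists>T\<subseteq>S. card T = l \<and> (\<forall>i\<in>T. \<forall>j\<in>S - T. f j \<le> f i)" using assms(2)
  proof (induction l)
    case 0
    then show ?case by (intro exI[of _ "{}"]) auto
  next
    case (Suc l)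
    then obtain T where T: "T \<subseteq> S" "card T = l" "\<forall>i\<in>T. \<forall>j\<in>S - T. f j \<le> f i" by auto
    have "S - T \<noteq> {}" using T Suc.prems assms(1)
      using card_mono[of T S] finite_subset[OF T(1) assms(1)] by auto
    moreover have "finite (S - T)" using assms(1) by simp
    ultimately have "Max (f ` (S - T)) \<in> f ` (S - T)" "\<And>j. j \<in> S - T \<Longrightarrow> f j \<le> Max (f ` (S - T))"
      by (simp_all add: Max_in)
    then obtain m where m: "m \<in> S - T" "\<And>j. j \<in> S - T \<Longrightarrow> f j \<le> f m" by (elim imageE) simp
    have "card (insert m T) = Suc l" using T m assms(1) finite_subset by fastforce
    then show ?case using T m by (intro exI[of _ "insert m T"]) auto
  qed
  then show ?thesis using that by blast
qed

text \<open>
  This is the gain from removing the largest entries: each remaining one is at most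
  the sum of all of them divided by \<open>l\<close>.
\<close>

lemma top_mean_ge:
  fixes f :: "'a \<Rightarrow> real"
  assumes "finite S" "T \<subseteq> S" "card T = l" "\<And>i j. i \<in> T \<Longrightarrow> j \<in> S - T \<Longrightarrow> f j \<le> f i"
    and "\<And>i. i \<in> S \<Longrightarrow> 0 \<le> f i" "j \<in> S - T"
  shows "real l * f j \<le> sum f S"
proof -
  have "real l * f j = (\<Sum>i\<in>T. f j)" using assms(3) by simp
  also have "\<dots> \<le> sum f T" using assms(4,6) by (intro sum_mono) auto
  also have "\<dots> \<le> sum f S" using assms(1,2,5) by (intro sum_mono2) auto
  finally show ?thesis .
qed

text \<open>
  The sum of the \<open>l\<close> largest absolute values is a norm, and its dual norm at \<open>u\<close> is the larger of
  \<open>\<parallel>u\<parallel>\<^sub>\<infinity>\<close> and \<open>\<parallel>u\<parallel>\<^sub>1 / l\<close>. Working with this duality avoids cutting the index set into blocks of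
  \<open>l\<close> elements and padding the last one.
\<close>

lemma sum_mult_le_top_sum:
  fixes u w :: "'a \<Rightarrow> real"
  assumes "finite S" "1 \<le> l" "l \<le> card S"
    and top: "\<And>J. J \<subseteq> S \<Longrightarrow> card J = l \<Longrightarrow> (\<Sum>j\<in>J. \<bar>w j\<bar>) \<le> W"
    and sup: "\<And>j. j \<in> S \<Longrightarrow> \<bar>u j\<bar> \<le> c"
    and l1: "(\<Sum>j\<in>S. \<bar>u j\<bar>) \<le> real l * c"
  shows "(\<Sum>j\<in>S. w j * u j) \<le> c * W"
proof -
  obtain J where J: "J \<subseteq> S" "card J = l" "\<And>i j. i \<in> J \<Longrightarrow> j \<in> S - J \<Longrightarrow> \<bar>w j\<bar> \<le> \<bar>w i\<bar>"
    using obtain_top_subset[OF assms(1,3), of "\<lambda>j. \<bar>w j\<bar>"] by metis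
  have fJ: "finite J" "J \<noteq> {}" using J assms finite_subset by auto
  \<comment> \<open>The \<open>l\<close>-th largest value separates the excess over it, paired with \<open>\<parallel>u\<parallel>\<^sub>\<infinity>\<close>, from a constant level, paired with \<open>\<parallel>u\<parallel>\<^sub>1\<close>.\<close>
  define th where "th = Min ((\<lambda>j. \<bar>w j\<bar>) ` J)"
  obtain i0 where i0: "i0 \<in> J" "th = \<bar>w i0\<bar>"
    using Min_in[of "(\<lambda>j. \<bar>w j\<bar>) ` J"] fJ unfolding th_def by blast
  have thle: "th \<le> \<bar>w j\<bar>" if "j \<in> J" for j using that fJ by (auto simp: th_def)
  have c0: "0 \<le> c" using sup i0(1) J(1) by (smt (verit) in_mono)
  have split: "sum f S = sum f J + sum f (S - J)" for f :: "'a \<Rightarrow> real"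
    using sum.subset_diff[OF J(1) assms(1), of f] by simp
  have "(\<Sum>j\<in>S. w j * u j) \<le> (\<Sum>j\<in>S. \<bar>w j\<bar> * \<bar>u j\<bar>)"
    by (intro sum_mono) (metis abs_ge_self abs_mult)
  also have "\<dots> \<le> (\<Sum>j\<in>S. (if j \<in> J then (\<bar>w j\<bar> - th) * c else 0) + th * \<bar>u j\<bar>)"
  proof (intro sum_mono)
    fix j assume j: "j \<in> S"
    show "\<bar>w j\<bar> * \<bar>u j\<bar> \<le> (if j \<in> J then (\<bar>w j\<bar> - th) * c else 0) + th * \<bar>u j\<bar>"
    proof (cases "j \<in> J")
      case True
      then have "(\<bar>w j\<bar> - th) * \<bar>u j\<bar> \<le> (\<bar>w j\<bar> - th) * c"
        using thle[OF True] sup[OF j] by (intro mult_left_mono) auto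
      then show ?thesis using True by (simp add: algebra_simps)
    next
      case False
      then have "\<bar>w j\<bar> * \<bar>u j\<bar> \<le> th * \<bar>u j\<bar>"
        using J(3)[OF i0(1), of j] i0(2) j by (intro mult_right_mono) auto
      then show ?thesis using False by simp
    qed
  qed
  also have "\<dots> = (\<Sum>j\<in>J. (\<bar>w j\<bar> - th) * c) + th * (\<Sum>j\<in>S. \<bar>u j\<bar>)"
    using assms(1) J(1) by (simp add: sum.distrib sum_distrib_left sum.If_cases Int_absorb1)
  also have "\<dots> = c * (\<Sum>j\<in>J. \<bar>w j\<bar>) - th * (real l * c) + th * (\<Sum>j\<in>S. \<bar>u j\<bar>)"
    using J(2) by (simp add: sum_subtractf sum_distrib_left sum_distrib_right algebra_simps)
  also have "\<dots> \<le> c * (\<Sum>j\<in>J. \<bar>w j\<bar>)"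
    using mult_left_mono[OF l1, of th] i0(2) by simp
  also have "\<dots> \<le> c * W" using top[OF J(1,2)] c0 by (rule mult_left_mono)
  finally show ?thesis .
qed

text \<open>
  This is \<open>\<parallel>v\<parallel>\<^sub>2\<^sup>2 \<le> \<parallel>v\<parallel>\<^sub>\<infinity> \<parallel>v\<parallel>\<^sub>1\<close>.
\<close>

lemma norm_le_of_sup_of_sum:
  assumes "\<And>j. j \<in> S \<Longrightarrow> \<bar>v $ j\<bar> \<le> c" "(\<Sum>j\<in>S. \<bar>v $ j\<bar>) \<le> l * c" "0 \<le> c" "0 \<le> l"
  shows "norm (restr S v) \<le> sqrt l * c"
proof (rule power2_le_imp_le)
  have "(norm (restr S v))\<^sup>2 \<le> (\<Sum>j\<in>S. c * \<bar>v $ j\<bar>)"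
    unfolding norm_restr_sq
    by (intro sum_mono) (metis abs_ge_zero assms(1) mult_right_mono power2_abs power2_eq_square)
  also have "\<dots> \<le> c * (l * c)"
    using assms(2,3) by (simp add: sum_distrib_left[symmetric] mult_left_mono)
  finally show "(norm (restr S v))\<^sup>2 \<le> (sqrt l * c)\<^sup>2"
    using assms(4) by (simp add: power_mult_distrib power2_eq_square[of c] mult.left_commute)
qed (use assms in auto)

section \<open>Optimality of the lasso solution and the cone condition\<close>

lemma quadratic_expansion:
  assumes "psd A"
  shows "(D + h *\<^sub>R e) \<bullet> (A *v (D + h *\<^sub>R e)) - 2 * (z \<bullet> (D + h *\<^sub>R e)) =
        D \<bullet> (A *v D) - 2 * (z \<bullet> D) + h * (2 * ((A *v D - z) \<bullet> e)) + h\<^sup>2 * (e \<bullet> (A *v e))"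
proof -
  have sym: "e \<bullet> (A *v D) = D \<bullet> (A *v e)" using assms psd_def by metis
  then have "(A *v D - z) \<bullet> e = D \<bullet> (A *v e) - z \<bullet> e"
    by (simp add: inner_diff_left inner_commute[of "A *v D" e])
  then show ?thesis
    unfolding matrix_vector_right_distrib matrix_vector_mult_scaleR inner_add_left inner_add_right
      inner_scaleR_left inner_scaleR_right sym
    by (simp add: power2_eq_square algebra_simps)
qed

text \<open>
  The objective is evaluated at a small step \<open>h\<close> from the minimiser towards \<open>b\<close>. The l1 norm is convex,
  so its growth is at most \<open>h\<close> times the full difference, while the quadratic remainder is of order
  \<open>h\<^sup>2\<close>. The conclusion replaces the subgradient conditions and can be tested against any \<open>b\<close>.
\<close>

lemma lasso_variational_inequality:
  fixes A :: "real ^ 'd ^ 'd"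
  assumes "psd A" "0 \<le> lam"
    and min: "\<And>b. (bhat - bbar) \<bullet> (A *v (bhat - bbar)) - 2 * (z \<bullet> (bhat - bbar)) + lam * (\<Sum>j\<in>UNIV. \<bar>bhat $ j\<bar>)
       \<le> (b - bbar) \<bullet> (A *v (b - bbar)) - 2 * (z \<bullet> (b - bbar)) + lam * (\<Sum>j\<in>UNIV. \<bar>b $ j\<bar>)"
  shows "0 \<le> 2 * ((A *v (bhat - bbar) - z) \<bullet> (b - bhat)) + lam * ((\<Sum>j\<in>UNIV. \<bar>b $ j\<bar>) - (\<Sum>j\<in>UNIV. \<bar>bhat $ j\<bar>))"
proof -
  define e D where "e = b - bhat" and "D = bhat - bbar"
  define q where "q = e \<bullet> (A *v e)"
  define n where "n b = (\<Sum>j\<in>UNIV. \<bar>b $ j\<bar>)" for b :: "real ^ 'd"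
  define g where "g = (A *v D - z) \<bullet> e"
  define L where "L = 2 * g + lam * (n b - n bhat)"
  have h: "0 \<le> L + h * q" if h: "0 < h" "h \<le> 1" for h
  proof -
    have l1: "n (bhat + h *\<^sub>R e) \<le> (1 - h) * n bhat + h * n b"
      unfolding n_def sum_distrib_left sum.distrib[symmetric]
    proof (intro sum_mono)
      fix j
      have "(bhat + h *\<^sub>R e) $ j = (1 - h) * bhat $ j + h * b $ j" by (simp add: e_def algebra_simps)
      then show "\<bar>(bhat + h *\<^sub>R e) $ j\<bar> \<le> (1 - h) * \<bar>bhat $ j\<bar> + h * \<bar>b $ j\<bar>"
        using h abs_triangle_ineq[of "(1 - h) * bhat $ j" "h * b $ j"] by (simp add: abs_mult)
    qed
    have bb: "bhat + h *\<^sub>R e - bbar = D + h *\<^sub>R e" by (simp add: D_def)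
    have "0 \<le> h * (2 * g) + h\<^sup>2 * q + lam * (n (bhat + h *\<^sub>R e) - n bhat)"
      using min[of "bhat + h *\<^sub>R e"] quadratic_expansion[OF assms(1), of D h e z]
      unfolding bb D_def[symmetric] n_def[symmetric] q_def g_def right_diff_distrib by linarith
    also have "\<dots> \<le> h * (2 * g) + h\<^sup>2 * q + lam * (h * (n b - n bhat))"
      using l1 assms(2) by (intro add_left_mono mult_left_mono) (auto simp: left_diff_distrib right_diff_distrib)
    also have "\<dots> = h * (L + h * q)" by (simp add: L_def power2_eq_square ring_distribs)
    finally show ?thesis using h(1) by (simp add: zero_le_mult_iff)
  qed
  have q0: "0 \<le> q" using assms(1) by (simp add: psd_def q_def)
  have "0 \<le> L"
  proof (rule ccontr)
    assume neg: "\<not> 0 \<le> L"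
    \<comment> \<open>For this step the remainder \<open>h q\<close> cancels at most half of a negative \<open>L\<close>.\<close>
    define h where "h = min 1 (- L / (2 * (q + 1)))"
    have "0 < - L / (2 * (q + 1))" using neg q0 by (intro divide_pos_pos) auto
    then have "0 < h" "h \<le> 1" by (auto simp: h_def)
    then have "0 \<le> L + h * q" by (rule h)
    also have "h * q \<le> (- L / (2 * (q + 1))) * q"
      using q0 by (intro mult_right_mono) (auto simp: h_def)
    also have "\<dots> \<le> - L / 2"
    proof -
      have "- L / (2 * (q + 1)) * q = (- L / 2) * (q / (q + 1))" by simp
      also have "\<dots> \<le> (- L / 2) * 1"
        using neg q0 by (intro mult_left_mono) auto
      finally show ?thesis by simp
    qed
    finally show False using neg by simp
  qed
  then show ?thesis unfolding L_def g_def n_def D_def e_def .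
qed

text \<open>
  The variational inequality is used with \<open>b = bbar\<close>. On \<open>F\<close> the penalty can grow by at most \<open>\<bar>D\<^sub>j\<bar>\<close>;
  off \<open>F\<close>, where \<open>D = bhat\<close>, it decreases by \<open>\<bar>D\<^sub>j\<bar>\<close> up to the tail of \<open>bbar\<close>. The noise
  perturbs both slopes by \<open>tau\<close>.
\<close>

lemma lasso_cone:
  fixes A :: "real ^ 'd ^ 'd" and bhat bbar :: "real ^ 'd" and F :: "'d set"
  defines "D \<equiv> bhat - restr F bbar"
  assumes "psd A" "0 \<le> lam" "\<And>j. \<bar>z $ j\<bar> \<le> tau"
    and vi: "0 \<le> 2 * ((A *v (bhat - bbar) - z) \<bullet> (bbar - bhat))
             + lam * ((\<Sum>j\<in>UNIV. \<bar>bbar $ j\<bar>) - (\<Sum>j\<in>UNIV. \<bar>bhat $ j\<bar>))"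
  shows "(lam / 2 - tau) * (\<Sum>j\<in>- F. \<bar>D $ j\<bar>)
           \<le> (lam / 2 + tau) * ((\<Sum>j\<in>F. \<bar>D $ j\<bar>) + (\<Sum>j\<in>- F. \<bar>bbar $ j\<bar>))"
proof -
  let ?e = "bhat - bbar"
  have tau0: "0 \<le> tau" using assms(4) by (meson abs_ge_zero order_trans)
  have q: "0 \<le> ?e \<bullet> (A *v ?e)" using assms(2) by (simp add: psd_def)
  have "(w - z) \<bullet> (bbar - bhat) = z \<bullet> ?e - ?e \<bullet> w" for w
    by (simp add: inner_diff_left inner_diff_right inner_commute)
  from this[of "A *v ?e"] have "0 \<le> 2 * (z \<bullet> ?e) + lam * ((\<Sum>j\<in>UNIV. \<bar>bbar $ j\<bar>) - (\<Sum>j\<in>UNIV. \<bar>bhat $ j\<bar>))"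
    using vi q by linarith
  also have "\<dots> = (\<Sum>j\<in>UNIV. 2 * (z $ j * ?e $ j) + lam * (\<bar>bbar $ j\<bar> - \<bar>bhat $ j\<bar>))"
    by (simp only: inner_vec_def sum_distrib_left sum.distrib sum_subtractf[symmetric] inner_real_def)
  also have "\<dots> \<le> (\<Sum>j\<in>UNIV. if j \<in> F then (lam + 2 * tau) * \<bar>D $ j\<bar>
       else (lam + 2 * tau) * \<bar>bbar $ j\<bar> - (lam - 2 * tau) * \<bar>D $ j\<bar>)"
  proof (intro sum_mono)
    fix j
    have "z $ j * ?e $ j \<le> \<bar>z $ j\<bar> * \<bar>?e $ j\<bar>"
      by (simp only: abs_mult[symmetric] abs_ge_self)
    moreover have "\<bar>z $ j\<bar> * \<bar>?e $ j\<bar> \<le> tau * \<bar>?e $ j\<bar>"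
      using assms(4)[of j] by (intro mult_right_mono) auto
    moreover have "tau * \<bar>?e $ j\<bar> \<le> tau * (\<bar>bhat $ j\<bar> + \<bar>bbar $ j\<bar>)"
      using tau0 by (intro mult_left_mono) auto
    moreover have "lam * (\<bar>bbar $ j\<bar> - \<bar>bhat $ j\<bar>) \<le> lam * \<bar>?e $ j\<bar>"
      using assms(3) by (intro mult_left_mono) auto
    ultimately show "2 * (z $ j * ?e $ j) + lam * (\<bar>bbar $ j\<bar> - \<bar>bhat $ j\<bar>)
       \<le> (if j \<in> F then (lam + 2 * tau) * \<bar>D $ j\<bar>
       else (lam + 2 * tau) * \<bar>bbar $ j\<bar> - (lam - 2 * tau) * \<bar>D $ j\<bar>)"
      by (simp add: D_def ring_distribs)
  qed
  also have "\<dots> = (lam + 2 * tau) * (\<Sum>j\<in>F. \<bar>D $ j\<bar>)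
     + ((lam + 2 * tau) * (\<Sum>j\<in>- F. \<bar>bbar $ j\<bar>) - (lam - 2 * tau) * (\<Sum>j\<in>- F. \<bar>D $ j\<bar>))"
    by (simp add: sum.If_cases sum_distrib_left sum_subtractf)
  finally show ?thesis by (simp add: ring_distribs)
qed

text \<open>
  The lower bound on \<open>lam\<close> is made for this: it gives \<open>X \<le> Y (4 - t) / (4 - 3 t)\<close>, and
  \<open>(1 - t) (4 - t) \<le> (4 - 3 t) (1 - t/2)\<close> since the two sides differ by \<open>t\<^sup>2 / 2\<close>. The factor \<open>1 - t\<close>
  is the one that \<open>pi2\<close> contributes later.
\<close>

lemma cone_ratio:
  fixes lam tau t X Y :: real
  assumes "0 < lam" "0 < t" "t \<le> 1" "4 * (2 - t) * tau \<le> lam * t" "0 \<le> X" "0 \<le> Y"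
    and cone: "(lam / 2 - tau) * X \<le> (lam / 2 + tau) * Y"
  shows "(1 - t) * X \<le> (1 - t / 2) * Y" "X \<le> 3 * Y" "tau \<le> lam / 4"
proof -
  let ?m = "4 * (2 - t)"
  have m: "0 < ?m" using assms by simp
  have "lam * (4 - 3 * t) * X = (?m * (lam / 2) - lam * t) * X" by (simp add: algebra_simps)
  also have "\<dots> \<le> (?m * (lam / 2) - ?m * tau) * X"
    using assms by (intro mult_right_mono) auto
  also have "\<dots> = ?m * ((lam / 2 - tau) * X)" by (simp add: algebra_simps)
  also have "\<dots> \<le> ?m * ((lam / 2 + tau) * Y)" using m cone by (intro mult_left_mono) auto
  also have "\<dots> = (?m * (lam / 2) + ?m * tau) * Y" by (simp add: algebra_simps)
  also have "\<dots> \<le> (?m * (lam / 2) + lam * t) * Y"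
    using assms by (intro mult_right_mono) auto
  also have "\<dots> = lam * (4 - t) * Y" by (simp add: algebra_simps)
  finally have "lam * ((4 - 3 * t) * X) \<le> lam * ((4 - t) * Y)" by (simp add: mult.assoc)
  then have r: "(4 - 3 * t) * X \<le> (4 - t) * Y" using assms(1) by simp
  have p: "0 < 4 - 3 * t" using assms by simp
  have "(4 - 3 * t) * ((1 - t) * X) = (1 - t) * ((4 - 3 * t) * X)" by simp
  also have "\<dots> \<le> (1 - t) * ((4 - t) * Y)" using r assms by (intro mult_left_mono) auto
  also have "\<dots> = ((1 - t) * (4 - t)) * Y" by simp
  also have "\<dots> \<le> ((4 - 3 * t) * (1 - t / 2)) * Y"
    using assms(6) by (intro mult_right_mono) (auto simp: algebra_simps)
  finally show "(1 - t) * X \<le> (1 - t / 2) * Y" using p by (simp add: mult.assoc)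
  have "(4 - t) * Y \<le> ((4 - 3 * t) * 3) * Y" using assms by (intro mult_right_mono) auto
  with r have "(4 - 3 * t) * X \<le> (4 - 3 * t) * (3 * Y)" by (simp only: mult.assoc) 
  then show "X \<le> 3 * Y" using p by (simp only: mult_le_cancel_left_pos)
  have "lam * t \<le> lam * (2 - t)" using assms by (intro mult_left_mono) auto
  also have "\<dots> = ?m * (lam / 4)" by simp
  finally have "?m * tau \<le> ?m * (lam / 4)" using assms(4) by (rule order_trans[rotated])
  then show "tau \<le> lam / 4" using m by (simp only: mult_le_cancel_left_pos)
qed

text \<open>
  The variational inequality is used with \<open>b = bhat - restr I D\<close>, which equals \<open>bbar\<close> on \<open>F\<close>, zero on the
  rest of \<open>I\<close> and \<open>bhat\<close> elsewhere. On \<open>I - F\<close> the penalty drops by \<open>lam \<bar>D\<^sub>j\<bar>\<close>, which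
  outweighs the noise there; only \<open>F\<close> contributes. Since \<open>bhat - bbar\<close> is \<open>D\<close> minus the tail of
  \<open>bbar\<close>, the tail enters through \<open>A\<close> alone and not through the penalty.
\<close>

lemma lasso_local_upper:
  fixes A :: "real ^ 'd ^ 'd" and bhat bbar :: "real ^ 'd" and F :: "'d set"
  defines "D \<equiv> bhat - restr F bbar"
  assumes "0 \<le> lam" "\<And>j. \<bar>z $ j\<bar> \<le> tau" "tau \<le> lam / 4" "F \<subseteq> I"
    and vi: "0 \<le> 2 * ((A *v (bhat - bbar) - z) \<bullet> ((bhat - restr I D) - bhat))
             + lam * ((\<Sum>j\<in>UNIV. \<bar>(bhat - restr I D) $ j\<bar>) - (\<Sum>j\<in>UNIV. \<bar>bhat $ j\<bar>))"
  shows "restr I D \<bullet> (A *v D) \<le> 3 / 4 * lam * (\<Sum>j\<in>F. \<bar>D $ j\<bar>) + restr I D \<bullet> (A *v restr (- F) bbar)"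
proof -
  have eq: "bhat - bbar = D - restr (- F) bbar" by (auto simp: vec_eq_iff D_def)
  have "(A *v (bhat - bbar) - z) \<bullet> ((bhat - restr I D) - bhat)
     = - (restr I D \<bullet> (A *v D)) + restr I D \<bullet> (A *v restr (- F) bbar) + restr I D \<bullet> z"
  proof -
    have "(bhat - restr I D) - bhat = - restr I D" by simp
    then show ?thesis unfolding eq matrix_vector_mult_diff_distrib
      by (simp only: inner_minus_right inner_diff_left)
        (simp add: inner_commute[of _ "restr I D"])
  qed
  then have "2 * (restr I D \<bullet> (A *v D)) \<le> 2 * (restr I D \<bullet> (A *v restr (- F) bbar))
     + (2 * (restr I D \<bullet> z) + lam * ((\<Sum>j\<in>UNIV. \<bar>(bhat - restr I D) $ j\<bar>) - (\<Sum>j\<in>UNIV. \<bar>bhat $ j\<bar>)))"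
    using vi by linarith
  also have "2 * (restr I D \<bullet> z) + lam * ((\<Sum>j\<in>UNIV. \<bar>(bhat - restr I D) $ j\<bar>) - (\<Sum>j\<in>UNIV. \<bar>bhat $ j\<bar>))
     = (\<Sum>j\<in>UNIV. 2 * (restr I D $ j * z $ j) + lam * (\<bar>(bhat - restr I D) $ j\<bar> - \<bar>bhat $ j\<bar>))"
    by (simp only: inner_vec_def sum_distrib_left sum.distrib sum_subtractf[symmetric] inner_real_def)
  also have "\<dots> \<le> (\<Sum>j\<in>UNIV. if j \<in> F then 3 / 2 * lam * \<bar>D $ j\<bar> else 0)"
  proof (intro sum_mono)
    fix j
    have zz: "2 * (D $ j * z $ j) \<le> 1 / 2 * lam * \<bar>D $ j\<bar>"
    proof -
      have "D $ j * z $ j \<le> \<bar>D $ j\<bar> * \<bar>z $ j\<bar>" by (metis abs_ge_self abs_mult)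
      also have "\<dots> \<le> \<bar>D $ j\<bar> * (lam / 4)"
        using assms(3)[of j] assms(4) by (intro mult_left_mono) auto
      finally show ?thesis by (simp add: algebra_simps)
    qed
    consider "j \<in> F" | "j \<notin> F" "j \<in> I" | "j \<notin> I" by blast
    then show "2 * (restr I D $ j * z $ j) + lam * (\<bar>(bhat - restr I D) $ j\<bar> - \<bar>bhat $ j\<bar>)
        \<le> (if j \<in> F then 3 / 2 * lam * \<bar>D $ j\<bar> else 0)"
    proof cases
      case 1
      have "lam * (\<bar>(bhat - restr I D) $ j\<bar> - \<bar>bhat $ j\<bar>) \<le> lam * \<bar>D $ j\<bar>"
        using assms(2,5) 1 by (intro mult_left_mono) auto
      then show ?thesis using 1 assms(5) zz by auto
    next
      case 2
      have "lam * (\<bar>(bhat - restr I D) $ j\<bar> - \<bar>bhat $ j\<bar>) = - (lam * \<bar>D $ j\<bar>)"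
        using 2 by (simp add: D_def)
      moreover have "0 \<le> lam * \<bar>D $ j\<bar>" using assms(2) by simp
      ultimately show ?thesis using 2 zz by simp
    next
      case 3
      then show ?thesis using assms(5) by auto
    qed
  qed
  also have "\<dots> = 3 / 2 * lam * (\<Sum>j\<in>F. \<bar>D $ j\<bar>)"
    by (simp add: sum.If_cases sum_distrib_left)
  finally show ?thesis by simp
qed

section \<open>Bounds for the quadratic form on a block\<close>

lemma sum_abs_mult_le_rho2:
  fixes A :: "real ^ 'd ^ 'd"
  assumes "psd A" "card I = m" "card J = l" "l \<le> m"
  shows "(\<Sum>j\<in>J. \<bar>(A *v restr I v) $ j\<bar>) \<le> sqrt (real l) * (rho2 A m * norm (restr I v))"
proof -
  have "(\<Sum>j\<in>J. \<bar>(A *v restr I v) $ j\<bar>) \<le> sqrt (real (card J)) * norm (restr J (A *v restr I v))"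
    by (rule sum_abs_le_norm_restr)
  also have "\<dots> \<le> sqrt (real l) * (rho2 A m * norm (restr I v))"
    using assms norm_restr_mult_le_rho2_cross[OF assms(1,2), of J v] by (simp add: mult_left_mono)
  finally show ?thesis .
qed

text \<open>
  The \<open>l\<close> largest entries of \<open>b\<close> on \<open>S\<close> are paired with \<open>A v\<^sub>I\<close> by Cauchy-Schwarz, which costs the l2 norm;
  the other entries are spread out and cost only \<open>\<parallel>b\<parallel>\<^sub>1 / \<surd>l\<close>.
\<close>

lemma form_tail_le_rho2:
  fixes A :: "real ^ 'd ^ 'd"
  assumes "psd A" "card I = m" "1 \<le> l" "l \<le> m" "2 * l \<le> card S"
  shows "restr I v \<bullet> (A *v restr S b)
     \<le> norm (restr I v) * rho2 A m * (norm (restr S b) + (\<Sum>j\<in>S. \<bar>b $ j\<bar>) / sqrt (real l))"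
proof -
  let ?w = "A *v restr I v" and ?N = "norm (restr I v)" and ?r1 = "\<Sum>j\<in>S. \<bar>b $ j\<bar>"
  have l0: "0 < real l" using assms by simp
  have rN: "0 \<le> rho2 A m * ?N"
    using norm_restr_mult_le_rho2[OF assms(2), of A v] norm_ge_zero order_trans by blast
  obtain B where B: "B \<subseteq> S" "card B = l" "\<And>i j. i \<in> B \<Longrightarrow> j \<in> S - B \<Longrightarrow> \<bar>b $ j\<bar> \<le> \<bar>b $ i\<bar>"
    using obtain_top_subset[of S l "\<lambda>j. \<bar>b $ j\<bar>"] assms(5) by auto
  have "restr I v \<bullet> (A *v restr S b) = restr S b \<bullet> ?w" using assms(1) psd_def by metis
  also have "\<dots> = (\<Sum>j\<in>B. b $ j * ?w $ j) + (\<Sum>j\<in>S - B. ?w $ j * b $ j)"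
    unfolding inner_restr using sum.subset_diff[OF B(1), of "\<lambda>j. b $ j * ?w $ j"]
    by (simp add: mult.commute)
  also have "(\<Sum>j\<in>B. b $ j * ?w $ j) \<le> norm (restr S b) * (rho2 A m * ?N)"
  proof -
    have "(\<Sum>j\<in>B. b $ j * ?w $ j) \<le> norm (restr B b) * norm (restr B ?w)"
      using restr_inner_le[of B b ?w] by (simp add: inner_restr)
    also have "\<dots> \<le> norm (restr S b) * (rho2 A m * ?N)"
      using B assms by (intro mult_mono norm_restr_mono norm_restr_mult_le_rho2_cross) auto
    finally show ?thesis .
  qed
  also have "(\<Sum>j\<in>S - B. ?w $ j * b $ j) \<le> (?r1 / real l) * (sqrt (real l) * (rho2 A m * ?N))"
  proof (rule sum_mult_le_top_sum[OF _ assms(3)])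
    show "l \<le> card (S - B)" using B assms(5) by (simp add: card_Diff_subset)
    show "(\<Sum>j\<in>J. \<bar>?w $ j\<bar>) \<le> sqrt (real l) * (rho2 A m * ?N)" if "card J = l" for J
      using that by (intro sum_abs_mult_le_rho2 assms)
    show "\<bar>b $ j\<bar> \<le> ?r1 / real l" if "j \<in> S - B" for j
      using top_mean_ge[OF _ B(1,2), of "\<lambda>j. \<bar>b $ j\<bar>" j] B(3) that l0
      by (simp add: pos_le_divide_eq mult.commute)
    have "(\<Sum>j\<in>S - B. \<bar>b $ j\<bar>) \<le> ?r1" by (intro sum_mono2) auto
    then show "(\<Sum>j\<in>S - B. \<bar>b $ j\<bar>) \<le> real l * (?r1 / real l)" using l0 by simp
  qed simp
  also have "(?r1 / real l) * (sqrt (real l) * (rho2 A m * ?N)) = ?r1 / sqrt (real l) * (rho2 A m * ?N)"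
  proof -
    have "real l = sqrt (real l) * sqrt (real l)" by simp
    then show ?thesis using l0 by (simp add: divide_simps)
  qed
  finally show ?thesis by (simp add: algebra_simps)
qed


text \<open>
  The product of \<open>A D\<^sub>I\<close> with \<open>D\<close> outside \<open>I\<close> is at most \<open>W X / l\<close>, where \<open>W\<close> bounds the sums of \<open>l\<close> entries
  of \<open>A D\<^sub>I\<close>. There are two such bounds, one from \<open>pi2\<close> and one from \<open>rho2\<close>. By the cone condition \<open>X\<close>
  consists of a part proportional to \<open>Y\<close> and a part proportional to \<open>r1\<close>. The first needs the
  bound by \<open>pi2\<close>, which makes it a fraction \<open>1 - t/2\<close> of the form; for the second the bound by \<open>rho2\<close>
  is the right one, as \<open>pi2\<close> would yield \<open>r1 / \<surd>k\<close> in place of \<open>r1 / \<surd>l\<close>.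
\<close>

lemma form_local_lower:
  fixes A :: "real ^ 'd ^ 'd" and D :: "real ^ 'd"
  assumes "psd A" "card I = m" "1 \<le> k" "1 \<le> l" "l \<le> m" "l \<le> card (- I)"
    and "pi2 A m l = ereal r" "t = 1 - r * sqrt (real k) / real l" "t \<le> 1"
    and sup: "\<And>j. j \<in> - I \<Longrightarrow> real l * \<bar>D $ j\<bar> \<le> X" and l1: "(\<Sum>j\<in>- I. \<bar>D $ j\<bar>) \<le> X" and "0 \<le> X" "0 \<le> Y" "0 \<le> r1"
    and c1: "(1 - t) * X \<le> (1 - t / 2) * (Y + r1)" and c3: "X \<le> 3 * (Y + r1)"
    and Y: "Y \<le> sqrt (real k) * norm (restr I D)"
  shows "t / 2 * (restr I D \<bullet> (A *v restr I D))
     \<le> restr I D \<bullet> (A *v D) + 3 * rho2 A m * norm (restr I D) * r1 / sqrt (real l)"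
proof (cases "restr I D = 0")
  case False
  let ?w = "A *v restr I D" and ?N = "norm (restr I D)"
  let ?Q = "restr I D \<bullet> ?w"
  define q where "q = ?Q / ?N"
  have N: "0 < ?N" using False by simp
  have k0: "0 < sqrt (real k)" and l0: "0 < real l" using assms by auto
  obtain J0 where J0: "J0 \<subseteq> - I" "card J0 = l" by (metis assms(6) obtain_subset_with_card_n)
  have Q: "0 < ?Q" using sum_abs_le_pi2(1)[OF assms(1,7,2) J0(2) _ assms(4) False] J0(1) by auto
  have q0: "0 < q" using Q N by (simp add: q_def)
  define W where "W = min (r * q) (sqrt (real l) * (rho2 A m * ?N))"
  have W: "(\<Sum>j\<in>J. \<bar>?w $ j\<bar>) \<le> W" if J: "J \<subseteq> - I" "card J = l" for J
  proof -
    have "(\<Sum>j\<in>J. \<bar>?w $ j\<bar>) * ?N \<le> r * ?Q"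
      using sum_abs_le_pi2(2)[OF assms(1,7,2) J(2) _ assms(4) False] J(1) by auto
    then have "(\<Sum>j\<in>J. \<bar>?w $ j\<bar>) \<le> r * q" using N by (simp add: q_def field_simps)
    then show ?thesis using sum_abs_mult_le_rho2[OF assms(1,2) J(2) assms(5), of D] by (simp add: W_def)
  qed
  have W0: "0 \<le> W" using W[OF J0] by (smt (verit) abs_ge_zero sum_nonneg)
  have cross: "(\<Sum>j\<in>- I. ?w $ j * (- D $ j)) \<le> X / real l * W"
  proof (rule sum_mult_le_top_sum[OF _ assms(4,6) W])
    show "\<bar>- D $ j\<bar> \<le> X / real l" if "j \<in> - I" for j
      using sup[OF that] l0 by (simp add: field_simps)
  qed (use l1 l0 in auto)
  have split: "restr I D \<bullet> (A *v D) = ?Q - (\<Sum>j\<in>- I. ?w $ j * (- D $ j))"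
  proof -
    have "restr I D \<bullet> (A *v D) = ?Q + restr I D \<bullet> (A *v restr (- I) D)"
      by (subst restr_split[of D I]) (simp add: matrix_vector_right_distrib inner_add_right)
    also have "restr I D \<bullet> (A *v restr (- I) D) = restr (- I) D \<bullet> ?w" using assms(1) psd_def by metis
    finally show ?thesis by (simp add: inner_restr sum_negf mult.commute)
  qed
  have rq: "r * q / real l = (1 - t) * (q / sqrt (real k))"
    using assms(8) k0 by simp
  have "X / real l * W \<le> (1 - t / 2) * ?Q + 3 * rho2 A m * ?N * r1 / sqrt (real l)"
  proof -
    have Wq: "W / real l \<le> (1 - t) * (q / sqrt (real k))"
      unfolding rq[symmetric] using l0 by (intro divide_right_mono) (auto simp: W_def)
    have Wr: "W / real l \<le> rho2 A m * ?N / sqrt (real l)"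
    proof -
      have "W / real l \<le> sqrt (real l) * (rho2 A m * ?N) / real l"
        using l0 by (intro divide_right_mono) (auto simp: W_def)
      also have "\<dots> = rho2 A m * ?N / sqrt (real l)"
      proof -
        have "real l = sqrt (real l) * sqrt (real l)" by simp
        then show ?thesis using l0 by (simp add: divide_simps)
      qed
      finally show ?thesis .
    qed
    show ?thesis
    proof (cases "Y + r1 = 0")
      case True
      then have "X = 0" using c3 assms(12) by simp
      moreover have "0 \<le> (1 - t / 2) * ?Q" using Q assms(9) by simp
      moreover have "0 \<le> rho2 A m * ?N / sqrt (real l)" using Wr W0 l0 by (smt (verit) divide_nonneg_pos)
      ultimately show ?thesis using True assms(13,14) by (simp add: add_nonneg_eq_0_iff)
    next
      case False
      then have YR: "0 < Y + r1" using assms by simp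
      \<comment> \<open>The two parts of \<open>X\<close>, in the ratio of \<open>Y\<close> to \<open>r1\<close>.\<close>
      let ?a = "X * Y / (Y + r1)" and ?b = "X * r1 / (Y + r1)"
      have ab: "X = ?a + ?b" using YR by (simp add: add_divide_distrib[symmetric] distrib_left[symmetric])
      have b: "?b \<le> 3 * r1"
      proof -
        have "X * (r1 / (Y + r1)) \<le> (3 * (Y + r1)) * (r1 / (Y + r1))"
          using c3 YR assms(14) by (intro mult_right_mono) auto
        also have "\<dots> = 3 * r1" using YR by (simp del: distrib_left_numeral)
        finally show ?thesis by simp
      qed
      have a: "(1 - t) * ?a \<le> (1 - t / 2) * Y"
      proof -
        have "((1 - t) * X) * (Y / (Y + r1)) \<le> ((1 - t / 2) * (Y + r1)) * (Y / (Y + r1))"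
          using c1 YR assms(13) by (intro mult_right_mono) auto
        also have "\<dots> = (1 - t / 2) * Y" using YR by simp
        finally show ?thesis by simp
      qed
      have "X / real l * W = (?a + ?b) / real l * W" by (simp only: ab[symmetric])
      then have "X / real l * W = ?a * (W / real l) + ?b * (W / real l)"
        by (simp only: times_divide_eq_left times_divide_eq_right distrib_right add_divide_distrib)
      moreover have "?a * (W / real l) \<le> (1 - t / 2) * ?Q"
      proof -
        have "?a * (W / real l) \<le> ?a * ((1 - t) * (q / sqrt (real k)))"
          using Wq assms YR by (intro mult_left_mono) auto
        also have "\<dots> = ((1 - t) * ?a) * (q / sqrt (real k))" by simp
        also have "\<dots> \<le> ((1 - t / 2) * Y) * (q / sqrt (real k))"
          using a q0 k0 by (intro mult_right_mono) auto
        also have "\<dots> \<le> ((1 - t / 2) * (sqrt (real k) * ?N)) * (q / sqrt (real k))"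
          using Y q0 k0 assms(9) by (intro mult_right_mono mult_left_mono) auto
        also have "\<dots> = (1 - t / 2) * ?Q" using k0 N by (simp add: q_def)
        finally show ?thesis .
      qed
      moreover have "?b * (W / real l) \<le> (3 * r1) * (rho2 A m * ?N / sqrt (real l))"
        using b Wr W0 l0 assms(14) by (intro mult_mono) auto
      moreover have "(3 * r1) * (rho2 A m * ?N / sqrt (real l)) = 3 * rho2 A m * ?N * r1 / sqrt (real l)"
        by simp
      ultimately show ?thesis by linarith
    qed
  qed
  moreover have "(1 - t / 2) * ?Q = ?Q - t / 2 * ?Q" by (simp only: left_diff_distrib mult_1)
  ultimately show ?thesis using cross split by linarith
qed simp


section \<open>The deterministic error bound\<close>

text \<open>
  Upper and lower bound for \<open>D\<^sub>I\<^sup>T A D\<close> combine to \<open>\<mu> N\<^sup>2 t / 2 \<le> N T\<close>, hence \<open>N \<le> 2 T / (t \<mu>)\<close>.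
  Outside \<open>I\<close> the cone condition gives at most \<open>3 N + 3 r\<^sub>1 / \<surd>l\<close>, so the total error is
  at most \<open>4 N + 3 r\<^sub>1 / \<surd>l + r\<^sub>2\<close>; the constants \<open>32\<close> and \<open>8\<close> are \<open>4\<close> times the
  coefficients \<open>8\<close> and \<open>2\<close> of \<open>r\<^sub>1 / \<surd>l\<close> and \<open>r\<^sub>2\<close> in the bound for \<open>N\<close>.
\<close>

lemma lasso_l2_bound:
  fixes A :: "real ^ 'd ^ 'd" and bhat bbar :: "real ^ 'd" and F :: "'d set"
  defines "r1 \<equiv> \<Sum>j\<in>- F. \<bar>bbar $ j\<bar>" and "r2 \<equiv> norm (restr (- F) bbar)"
  assumes "psd A" "0 < lam" "\<And>j. \<bar>z $ j\<bar> \<le> tau"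
    and vi: "\<And>b. 0 \<le> 2 * ((A *v (bhat - bbar) - z) \<bullet> (b - bhat))
             + lam * ((\<Sum>j\<in>UNIV. \<bar>b $ j\<bar>) - (\<Sum>j\<in>UNIV. \<bar>bhat $ j\<bar>))"
    and "card F = k" "1 \<le> k" "k \<le> l" "k + 2 * l \<le> CARD('d)"
    and "pi2 A (k + l) l = ereal r" "t = 1 - r * sqrt (real k) / real l" "0 < t"
    and "4 * (2 - t) * tau \<le> lam * t"
  shows "norm (bhat - bbar)
         \<le> (32 * rho2 A (k + l) / (t * mu2 A (k + l)) + 4) * r1 / sqrt (real l)
           + (8 * rho2 A (k + l) / (t * mu2 A (k + l)) + 4) * r2
           + 8 / (t * mu2 A (k + l)) * sqrt (real k) * lam"
proof -
  define D where "D = bhat - restr F bbar"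
  define m where "m = k + l"
  define X Y where "X = (\<Sum>j\<in>- F. \<bar>D $ j\<bar>)" and "Y = (\<Sum>j\<in>F. \<bar>D $ j\<bar>)"
  have l1: "1 \<le> l" and l0: "0 < sqrt (real l)" using assms by auto
  have nonneg: "0 \<le> X" "0 \<le> Y" "0 \<le> r1" "0 \<le> r2"
    by (simp_all add: X_def Y_def r1_def r2_def sum_nonneg)
  have cC: "card (- S) = CARD('d) - card S" for S :: "'d set"
    by (simp add: Compl_eq_Diff_UNIV card_Diff_subset)
  have cF: "card (- F) = CARD('d) - k" using assms(7) by (simp add: cC)
  have lF: "l \<le> card (- F)" using cF assms(10) by linarith
  obtain G where G: "G \<subseteq> - F" "card G = l" "\<And>i j. i \<in> G \<Longrightarrow> j \<in> - F - G \<Longrightarrow> \<bar>D $ j\<bar> \<le> \<bar>D $ i\<bar>"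
    using obtain_top_subset[OF finite lF, of "\<lambda>j. \<bar>D $ j\<bar>"] by blast
  define I where "I = F \<union> G"
  have I: "card I = m" unfolding I_def m_def
    using G assms(7) by (subst card_Un_disjoint) auto
  \<comment> \<open>This is where \<open>l \<le> (d - k) / 2\<close> enters: \<open>l\<close> indices are left outside \<open>I\<close> to test \<open>pi2\<close> with.\<close>
  have cI: "l \<le> card (- I)" using I assms(10) by (simp add: cC m_def)
  have mI: "- I = - F - G" by (auto simp: I_def)
  define N where "N = norm (restr I D)"
  have m1: "1 \<le> m" and m2: "m \<le> CARD('d)" using assms(8,10) by (auto simp: m_def)
  note mu = mu2_le_form[OF assms(3) m1]
  have mu0: "0 < mu2 A m" and r0: "0 \<le> r"
    using pi2_finite_imp[OF assms(3) assms(11)[folded m_def] m1 l1] assms(10) by (auto simp: m_def)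
  have t1: "t \<le> 1" using r0 assms(12) by simp
  have rho0: "0 \<le> rho2 A m" using assms(8,10) by (intro rho2_nonneg) (auto simp: m_def)
  have YN: "Y \<le> sqrt (real k) * N"
  proof -
    have "Y \<le> sqrt (real k) * norm (restr F D)"
      using sum_abs_le_norm_restr[of D F] assms(7) by (simp add: Y_def)
    also have "\<dots> \<le> sqrt (real k) * N"
      unfolding N_def by (intro mult_left_mono norm_restr_mono) (auto simp: I_def)
    finally show ?thesis .
  qed
  have cone: "(lam / 2 - tau) * X \<le> (lam / 2 + tau) * (Y + r1)"
    using lasso_cone[OF assms(3) less_imp_le[OF assms(4)] assms(5) vi[of bbar], of F]
    by (simp add: X_def Y_def r1_def D_def)
  have cr: "(1 - t) * X \<le> (1 - t / 2) * (Y + r1)" "X \<le> 3 * (Y + r1)" "tau \<le> lam / 4"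
    using cone_ratio[OF assms(4,13) t1 assms(14) nonneg(1) _ cone] nonneg by auto
  have sup: "real l * \<bar>D $ j\<bar> \<le> X" if "j \<in> - I" for j
    using top_mean_ge[OF _ G(1,2), of "\<lambda>j. \<bar>D $ j\<bar>" j] G(3) that by (simp add: X_def mI)
  have sumI: "(\<Sum>j\<in>- I. \<bar>D $ j\<bar>) \<le> X" unfolding X_def mI by (intro sum_mono2) auto
  define T where "T = 3 / 4 * lam * sqrt (real k) + rho2 A m * (r2 + r1 / sqrt (real l)) + 3 * rho2 A m * (r1 / sqrt (real l))"
  have "t / 2 * (mu2 A m * N\<^sup>2) \<le> t / 2 * (restr I D \<bullet> (A *v restr I D))"
    using mu[OF I] assms(13) unfolding N_def by (intro mult_left_mono) auto
  also have "\<dots> \<le> restr I D \<bullet> (A *v D) + 3 * rho2 A m * N * r1 / sqrt (real l)"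
    unfolding N_def
    using form_local_lower[OF assms(3) I assms(8) l1 _ cI assms(11)[folded m_def] assms(12) t1 sup sumI nonneg(1-3) cr(1,2)]
      YN by (simp add: m_def N_def)
  also have "restr I D \<bullet> (A *v D) \<le> 3 / 4 * lam * Y + restr I D \<bullet> (A *v restr (- F) bbar)"
    using lasso_local_upper[OF less_imp_le[OF assms(4)] assms(5) cr(3) _ vi[of "bhat - restr I D", unfolded D_def]]
    unfolding D_def Y_def I_def by simp
  also have "3 / 4 * lam * Y \<le> 3 / 4 * lam * (sqrt (real k) * N)"
    using YN assms(4) by (intro mult_left_mono) auto
  also have "restr I D \<bullet> (A *v restr (- F) bbar) \<le> N * rho2 A m * (r2 + r1 / sqrt (real l))"
    unfolding N_def r1_def r2_def using cF assms(10)
    by (intro form_tail_le_rho2 assms(3) I l1) (auto simp: m_def)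
  finally have main: "t / 2 * (mu2 A m * N\<^sup>2) \<le> N * T"
    by (simp add: T_def algebra_simps)
  have T0: "0 \<le> T" unfolding T_def using nonneg rho0 assms(4) l0 by simp
  have tm: "0 < t * mu2 A m" using assms(13) mu0 by simp
  have N: "N \<le> 2 * T / (t * mu2 A m)"
  proof (cases "N = 0")
    case True
    then show ?thesis using T0 tm by simp
  next
    case False
    then have "0 < N" by (simp add: N_def)
    moreover have "N * (t * mu2 A m * N) \<le> N * (2 * T)"
      using main by (simp add: power2_eq_square algebra_simps)
    ultimately have "t * mu2 A m * N \<le> 2 * T" by (simp only: mult_le_cancel_left_pos)
    then show ?thesis using tm by (simp add: pos_le_divide_eq mult.commute)
  qed
  have tail: "norm (restr (- I) D) \<le> 3 * N + 3 * (r1 / sqrt (real l))"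
  proof -
    have "norm (restr (- I) D) \<le> sqrt (real l) * (X / real l)"
      using sup sumI nonneg(1) l0 by (intro norm_le_of_sup_of_sum) (auto simp: field_simps)
    also have "\<dots> = X / sqrt (real l)"
    proof -
      have "real l = sqrt (real l) * sqrt (real l)" by simp
      then show ?thesis using l0 by (simp add: divide_simps)
    qed
    also have "\<dots> \<le> 3 * (sqrt (real k) * N + r1) / sqrt (real l)"
      using cr(2) YN l0 by (intro divide_right_mono) auto
    also have "\<dots> = 3 * (sqrt (real k) / sqrt (real l) * N) + 3 * (r1 / sqrt (real l))"
      by (simp add: add_divide_distrib)
    also have "sqrt (real k) / sqrt (real l) * N \<le> 1 * N"
      using assms(9) l0 by (intro mult_right_mono) (auto simp: N_def)
    finally show ?thesis by simp
  qed
  have "bhat - bbar = restr I D + restr (- I) D - restr (- F) bbar"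
    by (auto simp: vec_eq_iff D_def)
  then have "norm (bhat - bbar) \<le> N + norm (restr (- I) D) + r2"
    unfolding N_def r2_def
    using norm_triangle_ineq4[of "restr I D + restr (- I) D" "restr (- F) bbar"]
      norm_triangle_ineq[of "restr I D" "restr (- I) D"] by simp
  also have "\<dots> \<le> 4 * N + 3 * (r1 / sqrt (real l)) + r2" using tail by simp
  also have "\<dots> \<le> 4 * (2 * T / (t * mu2 A m)) + 3 * (r1 / sqrt (real l)) + r2" using N by simp
  also have "\<dots> \<le> (32 * rho2 A m / (t * mu2 A m) + 4) * r1 / sqrt (real l)
           + (8 * rho2 A m / (t * mu2 A m) + 4) * r2
           + 8 / (t * mu2 A m) * sqrt (real k) * lam"
  proof -
    define c where "c = 1 / (t * mu2 A m)"
    define s where "s = r1 / sqrt (real l)"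
    have c0: "0 \<le> c" and s0: "0 \<le> s" using tm nonneg l0 by (auto simp: c_def s_def)
    have "4 * (2 * T * c) + 3 * s + r2 = 6 * (c * sqrt (real k) * lam) + (32 * rho2 A m * c + 3) * s + (8 * rho2 A m * c + 1) * r2"
      by (simp add: T_def s_def[symmetric] algebra_simps)
    also have "\<dots> \<le> 8 * (c * sqrt (real k) * lam) + (32 * rho2 A m * c + 4) * s + (8 * rho2 A m * c + 4) * r2"
      using c0 s0 nonneg assms(4) rho0 by (intro add_mono mult_right_mono) auto
    finally show ?thesis by (simp add: c_def s_def)
  qed
  finally show ?thesis by (simp add: m_def)
qed

section \<open>Sorted tails, the empirical Gram matrix and the objective\<close>

lemma abs_desc_eq:
  fixes b :: "real ^ 'd"
  obtains js where "distinct js" "set js = UNIV" "abs_desc b = map (\<lambda>j. \<bar>b $ j\<bar>) js"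
proof -
  obtain xs :: "'d list" where xs: "set xs = UNIV" "distinct xs"
    using finite_distinct_list[OF finite] by blast
  let ?f = "\<lambda>j. \<bar>b $ j\<bar>"
  have "mset_set (UNIV :: 'd set) = mset xs" using xs by (metis mset_set_set)
  then have "sorted_list_of_multiset (image_mset ?f (mset_set UNIV)) = sort (map ?f xs)"
    by (simp flip: mset_map)
  also have "\<dots> = map ?f (sort_key ?f xs)"
    by (rule properties_for_sort) auto
  finally have "abs_desc b = map ?f (rev (sort_key ?f xs))" by (simp add: abs_desc_def rev_map)
  then show ?thesis using xs by (intro that[of "rev (sort_key ?f xs)"]) auto
qed

text \<open>
  The sorted list is the image of a permutation of the indices, and \<open>F\<close> consists of the first \<open>k\<close> of
  them. This turns the list sums into the sums over a complement in which the error bound is stated.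
\<close>

lemma r_tail_eq_off_top:
  fixes b :: "real ^ 'd"
  assumes "k \<le> CARD('d)"
  obtains F where "card F = k" "r_tail 1 k b = (\<Sum>j\<in>- F. \<bar>b $ j\<bar>)" "r_tail 2 k b = norm (restr (- F) b)"
proof -
  obtain js where js: "distinct js" "set js = UNIV" "abs_desc b = map (\<lambda>j. \<bar>b $ j\<bar>) js"
    by (rule abs_desc_eq)
  have len: "length js = CARD('d)" using js by (metis distinct_card)
  define F where "F = set (take k js)"
  have "card F = k" using len assms js(1) by (simp add: F_def distinct_card)
  moreover have dr: "- F = set (drop k js)"
    using js(1,2) set_take_disj_set_drop_if_distinct[OF js(1), of k k]
    by (metis F_def append_take_drop_id Compl_partition2 compl_unique order_refl set_append sup_commute inf_commute)
  have sum: "(\<Sum>z\<leftarrow>drop k (abs_desc b). f z) = (\<Sum>j\<in>- F. f \<bar>b $ j\<bar>)" for f :: "real \<Rightarrow> real"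
    unfolding js(3) dr using js(1)
    by (simp add: drop_map o_def sum_list_distinct_conv_sum_set)
  have "r_tail 1 k b = (\<Sum>j\<in>- F. \<bar>b $ j\<bar>)"
    by (simp add: r_tail_def sum sum_nonneg)
  moreover have "r_tail 2 k b = norm (restr (- F) b)"
    by (simp add: r_tail_def sum norm_restr L2_set_def powr_half_sqrt sum_nonneg)
  ultimately show ?thesis using that by blast
qed

lemma emp_gram_mult:
  fixes x :: "nat \<Rightarrow> real ^ 'd"
  shows "emp_gram n x *v v = (1 / real n) *\<^sub>R (\<Sum>i\<in>{1..n}. (x i \<bullet> v) *\<^sub>R x i)"
proof -
  have "((columnvector (x i) :: real ^ 1 ^ 'd) ** rowvector (x i)) *v v = (x i \<bullet> v) *\<^sub>R x i" for i
    by (simp add: vec_eq_iff matrix_vector_mult_def matrix_matrix_mult_def columnvector_def rowvector_def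
        inner_vec_def sum_distrib_left mult_ac)
  moreover have "(\<Sum>i\<in>{1..n}. B i) *v v = (\<Sum>i\<in>{1..n}. B i *v v)" for B :: "nat \<Rightarrow> real ^ 'd ^ 'd"
    by (induction n) (simp_all add: matrix_vector_mult_add_rdistrib)
  ultimately show ?thesis
    by (simp add: emp_gram_def scaleR_matrix_vector_assoc[symmetric])
qed

lemma emp_gram_form:
  "u \<bullet> (emp_gram n x *v v) = (\<Sum>i\<in>{1..n}. (x i \<bullet> u) * (x i \<bullet> v)) / real n"
  by (simp add: emp_gram_mult inner_sum_right inner_commute mult.commute)

lemma psd_emp_gram: "psd (emp_gram n x)"
  unfolding psd_def emp_gram_form
  by (auto simp: mult.commute intro!: divide_nonneg_nonneg sum_nonneg)

lemma emp_gram_diag: "emp_gram n x $ j $ j = (\<Sum>i\<in>{1..n}. (x i $ j)\<^sup>2) / real n"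
  by (simp add: emp_gram_def matrix_matrix_mult_def columnvector_def rowvector_def power2_eq_square)

text \<open>
  Half the negative gradient of the least squares part at the target, when \<open>e\<close> is the noise.
\<close>

definition score :: "nat \<Rightarrow> (nat \<Rightarrow> real ^ 'd) \<Rightarrow> (nat \<Rightarrow> real) \<Rightarrow> real ^ 'd" where
  "score n x e = (1 / real n) *\<^sub>R (\<Sum>i\<in>{1..n}. e i *\<^sub>R x i)"

text \<open>
  Completing the square at \<open>bbar\<close>: up to a constant, the data enter only through the Gram matrix and
  the score, which are all that the deterministic bound sees.
\<close>

lemma lasso_objective_eq:
  "lasso_objective n x y lam b =
     (b - bbar) \<bullet> (emp_gram n x *v (b - bbar)) - 2 * (score n x (\<lambda>i. y i - bbar \<bullet> x i) \<bullet> (b - bbar))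
     + lam * (\<Sum>j\<in>UNIV. \<bar>b $ j\<bar>) + (\<Sum>i\<in>{1..n}. (y i - bbar \<bullet> x i)\<^sup>2) / real n"
proof -
  have "(b \<bullet> x i - y i)\<^sup>2 = (x i \<bullet> (b - bbar)) * (x i \<bullet> (b - bbar))
      - 2 * ((y i - bbar \<bullet> x i) * (x i \<bullet> (b - bbar))) + (y i - bbar \<bullet> x i)\<^sup>2" for i
    by (simp add: inner_diff_right inner_commute power2_eq_square algebra_simps)
  then have "(\<Sum>i\<in>{1..n}. (b \<bullet> x i - y i)\<^sup>2) = (\<Sum>i\<in>{1..n}. (x i \<bullet> (b - bbar)) * (x i \<bullet> (b - bbar)))
      - 2 * (\<Sum>i\<in>{1..n}. (y i - bbar \<bullet> x i) * (x i \<bullet> (b - bbar))) + (\<Sum>i\<in>{1..n}. (y i - bbar \<bullet> x i)\<^sup>2)"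
    by (simp only: sum.distrib sum_subtractf sum_distrib_left)
  moreover have "score n x (\<lambda>i. y i - bbar \<bullet> x i) \<bullet> (b - bbar)
     = (\<Sum>i\<in>{1..n}. (y i - bbar \<bullet> x i) * (x i \<bullet> (b - bbar))) / real n"
    unfolding score_def inner_scaleR_left inner_sum_left by simp
  ultimately show ?thesis
    unfolding lasso_objective_def emp_gram_form
    by (simp add: add_divide_distrib diff_divide_distrib)
qed

section \<open>Sub-Gaussian noise\<close>

text \<open>
  Chernoff's inequality, with a strict conclusion because the main theorem asks for a
  probability larger than \<open>1 - \<delta>\<close>. Strictness is free: \<open>exp (s Z)\<close> exceeds \<open>exp (s \<tau>)\<close> times the indicator of
  \<open>Z > \<tau>\<close> at every point, by positivity off that event and by \<open>s > 0\<close> on it. For \<open>V = 0\<close> no finite \<open>s\<close>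
  is optimal; there \<open>exp Z + exp (- Z) - 2\<close> has expectation at most zero, so \<open>Z\<close> vanishes almost surely.
\<close>

lemma (in prob_space) subgaussian_tail_strict:
  assumes int: "\<And>s. integrable M (\<lambda>\<omega>. exp (s * Z \<omega>))"
    and mgf: "\<And>s. expectation (\<lambda>\<omega>. exp (s * Z \<omega>)) \<le> exp (V * s\<^sup>2 / 2)"
    and [measurable]: "Z \<in> borel_measurable M" and "0 \<le> V" "0 < p" "p < 1"
  shows "prob {\<omega> \<in> space M. Z \<omega> > sqrt (2 * V * ln (1 / p))} < p"
proof (cases "V = 0")
  case True
  let ?g = "\<lambda>\<omega>. exp (Z \<omega>) + exp (- Z \<omega>) - 2"
  have pos: "0 < exp a + exp (- a) - 2" if "a \<noteq> 0" for a :: real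
  proof -
    have "0 < (exp (a / 2) - exp (- a / 2))\<^sup>2" using that by simp
    also have "\<dots> = exp a + exp (- a) - 2"
      by (simp add: power2_diff exp_double[symmetric] exp_minus_inverse flip: exp_add)
    finally show ?thesis .
  qed
  have nn: "0 \<le> ?g \<omega>" for \<omega> using pos[of "Z \<omega>"] by (cases "Z \<omega> = 0") auto
  have i: "integrable M (\<lambda>\<omega>. exp (Z \<omega>))" "integrable M (\<lambda>\<omega>. exp (- Z \<omega>))"
    using int[of 1] int[of "-1"] by simp_all
  have "expectation ?g = expectation (\<lambda>\<omega>. exp (Z \<omega>)) + expectation (\<lambda>\<omega>. exp (- Z \<omega>)) - 2"
    using i by (simp add: prob_space)
  also have "\<dots> \<le> 0" using mgf[of 1] mgf[of "-1"] True by simp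
  finally have "expectation ?g = 0" using nn by (simp add: antisym integral_nonneg)
  then have "AE \<omega> in M. ?g \<omega> = 0"
    using integral_nonneg_eq_0_iff_AE[of M ?g] i nn by auto
  then have "AE \<omega> in M. \<not> (Z \<omega> > sqrt (2 * V * ln (1 / p)))"
  proof eventually_elim
    case (elim \<omega>)
    then show ?case using pos[of "Z \<omega>"] True by (cases "Z \<omega> = 0") auto
  qed
  then have "prob {\<omega> \<in> space M. Z \<omega> > sqrt (2 * V * ln (1 / p))} = 0"
    by (subst prob_eq_0) auto
  then show ?thesis using assms by simp
next
  case False
  then have V: "0 < V" using assms by simp
  define \<tau> where "\<tau> = sqrt (2 * V * ln (1 / p))"
  have lnp: "0 < ln (1 / p)" using assms by simp
  have tau2: "\<tau>\<^sup>2 = 2 * V * ln (1 / p)" using V lnp by (simp add: \<tau>_def)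
  have tau0: "0 < \<tau>" using V lnp by (simp add: \<tau>_def)
  \<comment> \<open>The minimiser of the exponent \<open>V s\<^sup>2 / 2 - s \<tau>\<close>.\<close>
  define s where "s = \<tau> / V"
  let ?T = "{\<omega> \<in> space M. Z \<omega> > \<tau>}"
  let ?h = "\<lambda>\<omega>. exp (s * Z \<omega>) - exp (s * \<tau>) * indicator ?T \<omega>"
  have s0: "0 < s" using tau0 V by (simp add: s_def)
  have hpos: "0 < ?h \<omega>" if "\<omega> \<in> space M" for \<omega>
    using s0 by (auto simp: indicator_def)
  have hi: "integrable M ?h" using int by (intro Bochner_Integration.integrable_diff) (auto simp: integrable_indicator_iff emeasure_eq_measure)
  have "expectation ?h \<noteq> 0"
  proof
    assume "expectation ?h = 0"
    then have "AE \<omega> in M. ?h \<omega> = 0"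
      using integral_nonneg_eq_0_iff_AE[OF hi] hpos by (metis (no_types, lifting) AE_I2 less_imp_le)
    then have "AE \<omega> in M. False" using AE_space by eventually_elim (use hpos in force)
    then show False by simp
  qed
  moreover have "0 \<le> expectation ?h" using hpos by (intro integral_nonneg_AE AE_I2) (simp add: less_imp_le)
  ultimately have "0 < expectation ?h" by simp
  also have "expectation ?h = expectation (\<lambda>\<omega>. exp (s * Z \<omega>)) - exp (s * \<tau>) * prob ?T"
    using int by (subst Bochner_Integration.integral_diff) (auto simp: integrable_indicator_iff emeasure_eq_measure)
  finally have "exp (s * \<tau>) * prob ?T < exp (V * s\<^sup>2 / 2)" using mgf[of s] by simp
  then have "prob ?T < exp (V * s\<^sup>2 / 2) / exp (s * \<tau>)" by (simp add: pos_less_divide_eq mult.commute)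
  also have "\<dots> = exp (V * s\<^sup>2 / 2 - s * \<tau>)" by (simp add: exp_diff)
  also have "V * s\<^sup>2 / 2 - s * \<tau> = - (\<tau>\<^sup>2 / (2 * V))"
    using V by (simp add: s_def power2_eq_square field_simps)
  also have "\<dots> = ln p" using V assms by (simp add: tau2 ln_div)
  finally show ?thesis using assms by (simp add: \<tau>_def)
qed


lemma (in prob_space) weighted_sum_subgaussian:
  fixes y :: "nat \<Rightarrow> 'a \<Rightarrow> real" and c m :: "nat \<Rightarrow> real" and sigma :: real
  assumes "indep_vars (\<lambda>_. borel) y S" "finite S"
    and int: "\<And>i s. i \<in> S \<Longrightarrow> integrable M (\<lambda>\<omega>. exp (s * (y i \<omega> - m i)))"
    and mgf: "\<And>i s. i \<in> S \<Longrightarrow> expectation (\<lambda>\<omega>. exp (s * (y i \<omega> - m i))) \<le> exp (sigma\<^sup>2 * s\<^sup>2 / 2)"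
  shows "integrable M (\<lambda>\<omega>. exp (s * (\<Sum>i\<in>S. c i * (y i \<omega> - m i))))"
    and "expectation (\<lambda>\<omega>. exp (s * (\<Sum>i\<in>S. c i * (y i \<omega> - m i))))
           \<le> exp ((sigma\<^sup>2 * (\<Sum>i\<in>S. (c i)\<^sup>2)) * s\<^sup>2 / 2)"
proof -
  let ?X = "\<lambda>i \<omega>. exp ((s * c i) * (y i \<omega> - m i))"
  have eq: "exp (s * (\<Sum>i\<in>S. c i * (y i \<omega> - m i))) = (\<Prod>i\<in>S. ?X i \<omega>)" for \<omega>
    using assms(2) by (simp add: exp_sum sum_distrib_left mult.assoc)
  have ind: "indep_vars (\<lambda>_. borel) ?X S"
    by (rule indep_vars_compose2[OF assms(1), where Y = "\<lambda>i v. exp ((s * c i) * (v - m i))"]) measurable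
  show "integrable M (\<lambda>\<omega>. exp (s * (\<Sum>i\<in>S. c i * (y i \<omega> - m i))))"
    unfolding eq by (rule indep_vars_integrable[OF assms(2) ind int])
  have "expectation (\<lambda>\<omega>. exp (s * (\<Sum>i\<in>S. c i * (y i \<omega> - m i)))) = (\<Prod>i\<in>S. expectation (?X i))"
    unfolding eq by (rule indep_vars_lebesgue_integral[OF assms(2) ind int])
  also have "\<dots> \<le> (\<Prod>i\<in>S. exp (sigma\<^sup>2 * (s * c i)\<^sup>2 / 2))"
    using mgf by (intro prod_mono) (auto intro!: integral_nonneg_AE)
  also have "\<dots> = exp ((sigma\<^sup>2 * (\<Sum>i\<in>S. (c i)\<^sup>2)) * s\<^sup>2 / 2)"
    using assms(2) by (simp add: exp_sum[symmetric] sum_distrib_left sum_distrib_right sum_divide_distrib power_mult_distrib mult_ac)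
  finally show "expectation (\<lambda>\<omega>. exp (s * (\<Sum>i\<in>S. c i * (y i \<omega> - m i))))
           \<le> exp ((sigma\<^sup>2 * (\<Sum>i\<in>S. (c i)\<^sup>2)) * s\<^sup>2 / 2)" .
qed

text \<open>
  A union bound over the \<open>d\<close> coordinates and the two signs, each of which fails with probability less
  than \<open>p = \<delta> / (2 d)\<close>. The variance proxy of a coordinate of the score is \<open>\<sigma>\<^sup>2 / n\<close> times a diagonal
  entry of the Gram matrix.
\<close>

lemma (in prob_space) score_sup_bound:
  fixes y :: "nat \<Rightarrow> 'a \<Rightarrow> real" and m :: "nat \<Rightarrow> real" and x :: "nat \<Rightarrow> real ^ 'd" and sigma delta :: real
  assumes a: "a = sqrt (SUP j. emp_gram n x $ j $ j)" and n: "1 \<le> n" and sg: "0 \<le> sigma" and dl: "0 < delta" "delta < 1"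
    and ind: "indep_vars (\<lambda>_. borel) y {1..n}"
    and int: "\<And>i s. i \<in> {1..n} \<Longrightarrow> integrable M (\<lambda>\<omega>. exp (s * (y i \<omega> - m i)))"
    and mgf: "\<And>i s. i \<in> {1..n} \<Longrightarrow> expectation (\<lambda>\<omega>. exp (s * (y i \<omega> - m i))) \<le> exp (sigma\<^sup>2 * s\<^sup>2 / 2)"
  shows "\<exists>E\<in>sets M. prob E > 1 - delta \<and>
    (\<forall>\<omega>\<in>E. \<forall>j. \<bar>score n x (\<lambda>i. y i \<omega> - m i) $ j\<bar>
       \<le> sigma * a * sqrt (2 * ln (2 * real CARD('d) / delta) / real n))"
proof -
  define \<tau> where "\<tau> = sigma * a * sqrt (2 * ln (2 * real CARD('d) / delta) / real n)"
  define p where "p = delta / (2 * real CARD('d))"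
  define V where "V = (sigma * a)\<^sup>2 / real n"
  define Z where "Z j \<omega> = score n x (\<lambda>i. y i \<omega> - m i) $ j" for j \<omega>
  have d1: "1 \<le> real CARD('d)" by (simp add: Suc_leI)
  have n0: "0 < real n" using n by simp
  have "delta < 2 * real CARD('d)" using dl d1 by linarith
  then have p: "0 < p" "p < 1" using dl by (auto simp: p_def divide_simps)
  have diag: "0 \<le> emp_gram n x $ j $ j" "emp_gram n x $ j $ j \<le> a\<^sup>2" for j
  proof -
    have le: "emp_gram n x $ i $ i \<le> (SUP j. emp_gram n x $ j $ j)" for i
      by (rule cSUP_upper) (auto simp: bdd_above_finite)
    show j0: "0 \<le> emp_gram n x $ j $ j" by (simp add: emp_gram_diag sum_nonneg)
    show "emp_gram n x $ j $ j \<le> a\<^sup>2" using le[of j] j0 by (simp add: a)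
  qed
  have a0: "0 \<le> a" using diag(1) unfolding a
    by (intro real_sqrt_ge_zero cSUP_upper2[of _ _ undefined]) (auto simp: bdd_above_finite)
  have tau: "\<tau> = sqrt (2 * V * ln (1 / p))"
    using sg a0 by (simp add: \<tau>_def V_def p_def real_sqrt_mult real_sqrt_divide)
  have meas: "y i \<in> borel_measurable M" if "i \<in> {1..n}" for i
    using ind that by (simp add: indep_vars_def2)
  have Zeq: "Z j \<omega> = (\<Sum>i\<in>{1..n}. (x i $ j / real n) * (y i \<omega> - m i))" for j \<omega>
    by (simp add: Z_def score_def sum_divide_distrib[symmetric] mult.commute)
  have Zm [measurable]: "Z j \<in> borel_measurable M" for j
    unfolding Zeq[abs_def] using meas by measurable
  have V: "0 \<le> V" by (simp add: V_def)
  have wt: "(\<Sum>i\<in>{1..n}. (u * x i $ j / real n)\<^sup>2) \<le> a\<^sup>2 / real n" if "u\<^sup>2 = 1" for j u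
  proof -
    have "(\<Sum>i\<in>{1..n}. (u * x i $ j / real n)\<^sup>2) = emp_gram n x $ j $ j / real n"
      using that unfolding emp_gram_diag
      by (simp add: sum_divide_distrib power_divide power_mult_distrib power2_eq_square[of "real n"])
    also have "\<dots> \<le> a\<^sup>2 / real n" using diag(2) n0 by (intro divide_right_mono) auto
    finally show ?thesis .
  qed
  have tail: "prob {\<omega> \<in> space M. u * Z j \<omega> > \<tau>} < p" if u: "u\<^sup>2 = 1" for u j
    unfolding tau
  proof (rule subgaussian_tail_strict[OF _ _ _ V p])
    let ?c = "\<lambda>i. u * x i $ j / real n"
    have eq: "u * Z j \<omega> = (\<Sum>i\<in>{1..n}. ?c i * (y i \<omega> - m i))" for \<omega>
      by (simp add: Zeq sum_distrib_left mult_ac)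
    show "integrable M (\<lambda>\<omega>. exp (s * (u * Z j \<omega>)))" for s
      unfolding eq by (rule weighted_sum_subgaussian(1)[OF ind _ int mgf]) auto
    have "expectation (\<lambda>\<omega>. exp (s * (u * Z j \<omega>))) \<le> exp ((sigma\<^sup>2 * (\<Sum>i\<in>{1..n}. (?c i)\<^sup>2)) * s\<^sup>2 / 2)" for s
      unfolding eq by (rule weighted_sum_subgaussian(2)[OF ind _ int mgf]) auto
    also have "exp ((sigma\<^sup>2 * (\<Sum>i\<in>{1..n}. (?c i)\<^sup>2)) * s\<^sup>2 / 2) \<le> exp (V * s\<^sup>2 / 2)" for s
    proof -
      have "sigma\<^sup>2 * (\<Sum>i\<in>{1..n}. (?c i)\<^sup>2) \<le> sigma\<^sup>2 * (a\<^sup>2 / real n)"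
        using wt[OF u] by (intro mult_left_mono) auto
      also have "\<dots> = V" by (simp add: V_def power_mult_distrib)
      finally show ?thesis by (simp add: mult_right_mono divide_right_mono)
    qed
    finally show "expectation (\<lambda>\<omega>. exp (s * (u * Z j \<omega>))) \<le> exp (V * s\<^sup>2 / 2)" for s .
    show "(\<lambda>\<omega>. u * Z j \<omega>) \<in> borel_measurable M" by measurable
  qed
  define B where "B j = {\<omega> \<in> space M. 1 * Z j \<omega> > \<tau>} \<union> {\<omega> \<in> space M. - 1 * Z j \<omega> > \<tau>}" for j
  have Bs: "B j \<in> sets M" for j unfolding B_def by measurable
  have Bp: "prob (B j) < 2 * p" for j
  proof -
    have "prob (B j) \<le> prob {\<omega> \<in> space M. 1 * Z j \<omega> > \<tau>} + prob {\<omega> \<in> space M. - 1 * Z j \<omega> > \<tau>}"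
      unfolding B_def by (intro measure_Un_le) measurable
    then show ?thesis using tail[of 1 j] tail[of "-1" j] by simp
  qed
  have "prob (\<Union>j. B j) \<le> (\<Sum>j\<in>UNIV. prob (B j))"
    using Bs by (intro finite_measure_subadditive_finite) auto
  also have "\<dots> < (\<Sum>j\<in>(UNIV :: 'd set). 2 * p)" using Bp by (intro sum_strict_mono) auto
  also have "\<dots> = delta" using d1 by (simp add: p_def)
  finally have U: "prob (\<Union>j. B j) < delta" .
  have "prob (space M - (\<Union>j. B j)) > 1 - delta"
    using U Bs by (subst prob_compl) auto
  moreover have "\<bar>Z j \<omega>\<bar> \<le> \<tau>" if "\<omega> \<in> space M - (\<Union>j. B j)" for j \<omega>
    using that by (auto simp: B_def not_less abs_le_iff)
  ultimately show ?thesis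
    using Bs by (intro bexI[of _ "space M - (\<Union>j. B j)"]) (auto simp: Z_def \<tau>_def)
qed

section \<open>The error bound with high probability\<close>

theorem corollary6p1:
  fixes M :: "'w measure"
    and n :: nat
    and x :: "nat \<Rightarrow> real ^ 'd"
    and y :: "nat \<Rightarrow> 'w \<Rightarrow> real"
    and sigma lam delta a :: real
    and A :: "real ^ 'd ^ 'd"
    and beta_bar :: "real ^ 'd"
    and beta_hat :: "'w \<Rightarrow> real ^ 'd"
  assumes "prob_space M"
    and "n \<ge> 1"
    and "prob_space.indep_vars M (\<lambda>_. borel) y {1..n}"
    and "sigma \<ge> 0"
    and "\<And>i. i \<in> {1..n} \<Longrightarrow> integrable M (y i)"
    and "\<And>i s. i \<in> {1..n} \<Longrightarrow>
           integrable M (\<lambda>\<omega>. exp (s * (y i \<omega> - integral\<^sup>L M (y i))))"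
    and "\<And>i s. i \<in> {1..n} \<Longrightarrow>
           (\<integral>\<omega>. exp (s * (y i \<omega> - integral\<^sup>L M (y i))) \<partial>M) \<le> exp (sigma\<^sup>2 * s\<^sup>2 / 2)"
    and "A = emp_gram n x"
    and "a = sqrt (SUP j. A $ j $ j)"
    and "\<And>i. i \<in> {1..n} \<Longrightarrow> integral\<^sup>L M (y i) = beta_bar \<bullet> x i"
    and "lam \<ge> 0"
    and "\<And>\<omega>. \<omega> \<in> space M \<Longrightarrow> 
           is_arg_min (lasso_objective n x (\<lambda>i. y i \<omega>) lam) (\<lambda>_. True) (beta_hat \<omega>)"
    and "\<And>\<omega> b. lam = 0 \<Longrightarrow> \<omega> \<in> space M \<Longrightarrow>
           is_arg_min (lasso_objective n x (\<lambda>i. y i \<omega>) lam) (\<lambda>_. True) b \<Longrightarrow> b = beta_hat \<omega>"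
    and "0 < delta" and "delta < 1"
  shows "\<exists>E\<in>sets M. measure M E > 1 - delta \<and>
    (\<forall>\<omega>\<in>E. \<forall>k l :: nat. \<forall>t :: real.
       k \<ge> 1 \<longrightarrow> (real CARD('d) - real k) / 2 \<ge> real l \<longrightarrow> l \<ge> k \<longrightarrow>
       ereal t = 1 - pi2 A (k + l) l * ereal (sqrt (real k)) / ereal (real l) \<longrightarrow> t > 0 \<longrightarrow>
       lam \<ge> 4 * (2 - t) / t * sigma * a * sqrt (2 * ln (2 * real CARD('d) / delta) / real n) \<longrightarrow>
       norm (beta_hat \<omega> - beta_bar)
         \<le> (32 * rho2 A (k + l) / (t * mu2 A (k + l)) + 4) * r_tail 1 k beta_bar / sqrt (real l)
           + (8 * rho2 A (k + l) / (t * mu2 A (k + l)) + 4) * r_tail 2 k beta_bar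
           + 8 / (t * mu2 A (k + l)) * sqrt (real k) * lam)"
proof -
  interpret prob_space M by (rule assms(1))
  define tau where "tau = sigma * a * sqrt (2 * ln (2 * real CARD('d) / delta) / real n)"
  define z where "z \<omega> = score n x (\<lambda>i. y i \<omega> - beta_bar \<bullet> x i)" for \<omega>
  have mean: "\<And>i. i \<in> {1..n} \<Longrightarrow> expectation (y i) = beta_bar \<bullet> x i" by (rule assms(10))
  obtain E where E: "E \<in> sets M" "prob E > 1 - delta" and zE: "\<And>\<omega> j. \<omega> \<in> E \<Longrightarrow> \<bar>z \<omega> $ j\<bar> \<le> tau"
    using score_sup_bound[OF assms(9)[unfolded assms(8)] assms(2,4,14,15,3), of "\<lambda>i. beta_bar \<bullet> x i"]
      assms(6,7) mean unfolding z_def tau_def by auto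
  have psdA: "psd A" unfolding assms(8) by (rule psd_emp_gram)
  have obj: "lasso_objective n x (\<lambda>i. y i \<omega>) lam b =
      (b - beta_bar) \<bullet> (A *v (b - beta_bar)) - 2 * (z \<omega> \<bullet> (b - beta_bar))
      + lam * (\<Sum>j\<in>UNIV. \<bar>b $ j\<bar>) + (\<Sum>i\<in>{1..n}. (y i \<omega> - beta_bar \<bullet> x i)\<^sup>2) / real n" for \<omega> b
    unfolding z_def assms(8) by (rule lasso_objective_eq)
  have opt: "lasso_objective n x (\<lambda>i. y i \<omega>) lam (beta_hat \<omega>) \<le> lasso_objective n x (\<lambda>i. y i \<omega>) lam b"
    if "\<omega> \<in> space M" for \<omega> b
    using assms(12)[OF that] by (simp add: is_arg_min_linorder)
  show ?thesis
  proof (intro bexI[OF _ E(1)] conjI E(2) ballI allI impI)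
    fix \<omega> k l t
    assume w: "\<omega> \<in> E" and k: "1 \<le> k" and dim: "real l \<le> (real CARD('d) - real k) / 2" and kl: "k \<le> l"
      and t: "ereal t = 1 - pi2 A (k + l) l * ereal (sqrt (real k)) / ereal (real l)" "0 < t"
      and lam: "4 * (2 - t) / t * sigma * a * sqrt (2 * ln (2 * real CARD('d) / delta) / real n) \<le> lam"
    have wM: "\<omega> \<in> space M" using w E(1) sets.sets_into_space by auto
    have "real (k + 2 * l) \<le> real CARD('d)" using dim by simp
    then have dim': "k + 2 * l \<le> CARD('d)" by (simp only: of_nat_le_iff)
    obtain r where r: "pi2 A (k + l) l = ereal r" "t = 1 - r * sqrt (real k) / real l"
      using pi2_finite[OF t(1) k] k kl by auto
    obtain F where F: "card F = k" "r_tail 1 k beta_bar = (\<Sum>j\<in>- F. \<bar>beta_bar $ j\<bar>)"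
        "r_tail 2 k beta_bar = norm (restr (- F) beta_bar)"
      using r_tail_eq_off_top[of k beta_bar] dim' by auto
    have "4 * (2 - t) / t * tau \<le> lam" using lam by (simp add: tau_def mult.assoc)
    then have lt: "4 * (2 - t) * tau \<le> lam * t" using t(2) by (simp add: pos_divide_le_eq)
    show "norm (beta_hat \<omega> - beta_bar)
         \<le> (32 * rho2 A (k + l) / (t * mu2 A (k + l)) + 4) * r_tail 1 k beta_bar / sqrt (real l)
           + (8 * rho2 A (k + l) / (t * mu2 A (k + l)) + 4) * r_tail 2 k beta_bar
           + 8 / (t * mu2 A (k + l)) * sqrt (real k) * lam"
    proof (cases "lam = 0")
      case False
      then have lam0: "0 < lam" using assms(11) by simp
      have vi: "0 \<le> 2 * ((A *v (beta_hat \<omega> - beta_bar) - z \<omega>) \<bullet> (b - beta_hat \<omega>))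
           + lam * ((\<Sum>j\<in>UNIV. \<bar>b $ j\<bar>) - (\<Sum>j\<in>UNIV. \<bar>beta_hat \<omega> $ j\<bar>))" for b
        using opt[OF wM] unfolding obj
        by (intro lasso_variational_inequality[OF psdA assms(11)]) simp
      show ?thesis unfolding F(2,3)
        by (rule lasso_l2_bound[OF psdA lam0 zE[OF w] vi F(1) k kl dim' r t(2) lt])
    next
      case True
      \<comment> \<open>Without regularisation the bound on the score forces it to be zero. Then the target minimises the
      objective, and uniqueness of the minimiser leaves no error at all.\<close>
      have "0 \<le> r" using pi2_finite_imp(2)[OF psdA r(1)] k kl dim' by simp
      then have t1: "t \<le> 1" using r(2) by simp
      have "tau \<le> 0" using lt True t1 t(2) by (simp add: mult_le_0_iff)
      then have "z \<omega> $ j = 0" for j using zE[OF w, of j] by simp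
      then have z0: "z \<omega> = 0" by (simp add: vec_eq_iff)
      have "is_arg_min (lasso_objective n x (\<lambda>i. y i \<omega>) lam) (\<lambda>_. True) beta_bar"
        unfolding is_arg_min_linorder obj using psdA by (simp add: z0 True psd_def)
      then have "beta_bar = beta_hat \<omega>" by (rule assms(13)[OF True wM])
      moreover have "0 \<le> rho2 A (k + l)" "0 \<le> mu2 A (k + l)" 
        using k dim' by (auto intro!: rho2_nonneg mu2_greatest divide_nonneg_nonneg)
      moreover have "0 \<le> r_tail 1 k beta_bar" "0 \<le> r_tail 2 k beta_bar"
        unfolding F(2,3) by (simp_all add: sum_nonneg)
      ultimately show ?thesis using t(2) True by simp
    qed
  qed
qed

end
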